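(* Let $A\in(\mathbb{Z}_{\max})^{n\times n}$ and $C\in(\mathbb{Z}_{\max})^{q\times n}$. Then the observable congruence $$\mathcal{O}_\omega=\{(\xi,\xi')\in((\mathbb{Z}_{\max})^n)^2\mid CA^k\xi=CA^k\xi'\text{ for all }k\ge 0\}$$ is a rational subsemimodule of $((\mathbb{Z}_{\max})^n)^2$.
   Context: $\mathbb{Z}_{\max}$ is the semiring with set $\mathbb{Z}\cup\{-\infty\}$, addition $\oplus=\max$, multiplication $\otimes=+$; its zero is $\varepsilon=-\infty$ and its unit is $e=0$. Matrix products (including products with column vectors and powers) are taken in this semiring: $(AB)_{ij}=\max_k(A_{ik}+B_{kj})$; $A^0$ is the max-plus identity matrix ($0$ on the diagonal, $-\infty$ elsewhere). The free semimodule $(\mathbb{Z}_{\max})^m$ has entrywise max as addition and action $(\lambda x)_i=\lambda+x_i$; $((\mathbb{Z}_{\max})^n)^2$ is identified with $(\mathbb{Z}_{\max})^{2n}$. For $G\subset(\mathbb{Z}_{\max})^m$, $\mathrm{span}\,G$ is the set of finite linear combinations $\bigoplus_{i=1}^k\lambda_iu^i$ with $u^i\in G$, $\lambda_i\in\mathbb{Z}_{\max}$. The class of rational subsets of a monoid $(M,\cdot)$ with unit $1_M$ is the least class of subsets of $M$ that contains all finite subsets and is closed under union, product $U\cdot V=\{u\cdot v\mid u\in U,v\in V\}$, and star $U^*=U^0\cup U\cup U^2\cup\cdots$, where $U^0=\{1_M\}$. A subsemimodule $\mathcal{X}\subset(\mathbb{Z}_{\max})^m$ is rational if $\mathcal{X}=\mathrm{span}\,G$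 for some rational subset $G$ of the monoid $((\mathbb{Z}\cup\{-\infty\})^m,+)$ (entrywise addition). *)

theory Defs
  imports "Jordan_Normal_Form.Matrix" "HOL-Algebra.Coset"
begin

section \<open>The max-plus semiring of integers\<close>

text \<open>The semiring operations are the class operations on \<open>zmax\<close>: \<open>+\<close> is max, \<open>*\<close> is addition
  of integers, \<open>0\<close> is minus infinity and \<open>1\<close> is the integer zero. Hence the library's matrix
  and vector operations over \<open>zmax\<close> are the max-plus ones.\<close>

datatype zmax = NegInf | Fin int

instantiation zmax :: linorder
begin

fun less_eq_zmax :: "zmax \<Rightarrow> zmax \<Rightarrow> bool" where
  "NegInf \<le> y \<longleftrightarrow> True"
| "Fin a \<le> NegInf \<longleftrightarrow> False"
| "Fin a \<le> Fin b \<longleftrightarrow> a \<le> b"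

definition less_zmax :: "zmax \<Rightarrow> zmax \<Rightarrow> bool" where
  "x < y \<longleftrightarrow> x \<le> y \<and> \<not> y \<le> x" for x y :: zmax

instance
proof
  fix x y z :: zmax
  show "x < y \<longleftrightarrow> x \<le> y \<and> \<not> y \<le> x" by (rule less_zmax_def)
  show "x \<le> x" by (cases x) auto
  show "x \<le> y \<Longrightarrow> y \<le> z \<Longrightarrow> x \<le> z" by (cases x; cases y; cases z) auto
  show "x \<le> y \<Longrightarrow> y \<le> x \<Longrightarrow> x = y" by (cases x; cases y) auto
  show "x \<le> y \<or> y \<le> x" by (cases x; cases y) auto
qed

end

instantiation zmax :: comm_semiring_1
begin

definition zero_zmax :: zmax where "0 = NegInf"

definition one_zmax :: zmax where "1 = Fin 0"

definition plus_zmax :: "zmax \<Rightarrow> zmax \<Rightarrow> zmax" where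
  "x + y = max x y" for x y :: zmax

fun times_zmax :: "zmax \<Rightarrow> zmax \<Rightarrow> zmax" where
  "NegInf * y = NegInf"
| "Fin a * NegInf = NegInf"
| "Fin a * Fin b = Fin (a + b)"

instance
proof
  fix x y z :: zmax
  show "x + y + z = x + (y + z)" by (simp add: plus_zmax_def max.assoc)
  show "x + y = y + x" by (simp add: plus_zmax_def max.commute)
  show "0 + x = x" by (cases x) (auto simp: plus_zmax_def zero_zmax_def max_def)
  show "x * y * z = x * (y * z)" by (cases x; cases y; cases z) auto
  show "x * y = y * x" by (cases x; cases y) auto
  show "1 * x = x" by (cases x) (auto simp: one_zmax_def)
  show "0 * x = 0" by (simp add: zero_zmax_def)
  show "x * 0 = 0" by (cases x) (auto simp: zero_zmax_def)
  show "(x + y) * z = x * z + y * z"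
    by (cases x; cases y; cases z) (auto simp: plus_zmax_def max_def)
  show "(0 :: zmax) \<noteq> 1" by (simp add: zero_zmax_def one_zmax_def)
qed

end

section \<open>Rational subsets of a monoid\<close>

primrec set_power :: "('a, 'b) monoid_scheme \<Rightarrow> 'a set \<Rightarrow> nat \<Rightarrow> 'a set" where
  "set_power M U 0 = {\<one>\<^bsub>M\<^esub>}"
| "set_power M U (Suc k) = set_power M U k <#>\<^bsub>M\<^esub> U"

definition set_star :: "('a, 'b) monoid_scheme \<Rightarrow> 'a set \<Rightarrow> 'a set" where
  "set_star M U = (\<Union>k. set_power M U k)"

inductive rational_subset :: "('a, 'b) monoid_scheme \<Rightarrow> 'a set \<Rightarrow> bool"
  for M :: "('a, 'b) monoid_scheme" where
  finite: "finite U \<Longrightarrow> U \<subseteq> carrier M \<Longrightarrow> rational_subset M U"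
| union: "rational_subset M U \<Longrightarrow> rational_subset M V \<Longrightarrow> rational_subset M (U \<union> V)"
| product: "rational_subset M U \<Longrightarrow> rational_subset M V \<Longrightarrow> rational_subset M (U <#>\<^bsub>M\<^esub> V)"
| star: "rational_subset M U \<Longrightarrow> rational_subset M (set_star M U)"

section \<open>Rational subsemimodules\<close>

text \<open>The monoid of vectors of length \<open>m\<close> under entrywise usual addition. This is entrywise
  multiplication of the semiring \<open>zmax\<close>, with the all-zeros integer vector as unit; it is not the
  addition of the semimodule, which is the entrywise maximum.\<close>

definition entrywise_monoid :: "nat \<Rightarrow> zmax vec monoid" where
  "entrywise_monoid m =
    \<lparr>carrier = carrier_vec m, mult = (\<lambda>u v. vec m (\<lambda>i. u $ i * v $ i)), one = vec m (\<lambda>i. 1)\<rparr>"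

definition subsemimodule :: "nat \<Rightarrow> zmax vec set \<Rightarrow> bool" where
  "subsemimodule m X \<longleftrightarrow>
     X \<subseteq> carrier_vec m \<and> 0\<^sub>v m \<in> X \<and>
     (\<forall>x\<in>X. \<forall>y\<in>X. x + y \<in> X) \<and> (\<forall>c. \<forall>x\<in>X. c \<cdot>\<^sub>v x \<in> X)"

text \<open>The empty combination is allowed, so the span of the empty set is the zero semimodule.\<close>

definition semimodule_span :: "nat \<Rightarrow> zmax vec set \<Rightarrow> zmax vec set" where
  "semimodule_span m G =
     {x. \<exists>(k::nat) (c :: nat \<Rightarrow> zmax) (u :: nat \<Rightarrow> zmax vec).
           (\<forall>i<k. u i \<in> G) \<and> x = finsum_vec TYPE(zmax) m (\<lambda>i. c i \<cdot>\<^sub>v u i) {..<k}}"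

definition rational_subsemimodule :: "nat \<Rightarrow> zmax vec set \<Rightarrow> bool" where
  "rational_subsemimodule m X \<longleftrightarrow>
     subsemimodule m X \<and>
     (\<exists>G. rational_subset (entrywise_monoid m) G \<and> X = semimodule_span m G)"

section \<open>The observable congruence\<close>

definition observable_congruence :: "nat \<Rightarrow> zmax mat \<Rightarrow> zmax mat \<Rightarrow> (zmax vec \<times> zmax vec) set" where
  "observable_congruence n A C =
     {(\<xi>, \<xi>'). \<xi> \<in> carrier_vec n \<and> \<xi>' \<in> carrier_vec n \<and>
        (\<forall>k. (C * A ^\<^sub>m k) *\<^sub>v \<xi> = (C * A ^\<^sub>m k) *\<^sub>v \<xi>')}"

text \<open>The identification of pairs of vectors of length \<open>n\<close> with vectors of length \<open>2 * n\<close>.\<close>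

definition pair_vec :: "zmax vec \<times> zmax vec \<Rightarrow> zmax vec" where
  "pair_vec p = fst p @\<^sub>v snd p"

end

theory Submission
  imports Defs "HOL-Library.Multiset" "HOL-Library.Set_Algebras" "HOL-Library.Product_Plus"
    "HOL-Library.Function_Algebras"
begin

text \<open>
  By Kleene's algorithm the lengths and weights of the walks between two vertices form a rational,
  hence semilinear, set of pairs; keeping in each linear part only the period of largest slope shows
  that every entry of \<open>C A\<^sup>k\<close> is, for large \<open>k\<close> and along each residue class of \<open>k\<close> modulo some
  \<open>D > 0\<close>, a maximum of finitely many affine functions. So the infinitely many equations reduce to
  finitely many of the form: for all \<open>p \<ge> 0\<close>, two maxima of affine functions of \<open>p\<close> agree, the
  constant terms being linear in \<open>(\<xi>, \<xi>')\<close>. The quantifier over \<open>p\<close> can be replaced by an existential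
  quantifier over one breakpoint, and sets given by linear inequalities and existential quantifiers
  are semilinear by Dickson's lemma. Treating each set of finite coordinates separately, the
  congruence itself is a rational set, and it is its own span.
\<close>

section \<open>Semilinear sets\<close>

text \<open>Entrywise addition is commutative, so \<open>nat_span\<close> (sums with multiplicities)
  plays the part of the star. Semilinear sets are used in two monoids: pairs of length and weight,
  and integer vectors holding the finite entries of the unknown pair. The main obstacle is the
  universal quantifier over \<open>p\<close>. Unions, sums, stars and projections of semilinear sets
  come straight from the definition, whereas a universal quantifier is the complement of a
  projection, and complements are much harder. Trading it for a breakpoint leaves finite
  conjunctions and disjunctions, linear inequalities and existential quantifiers. This works because
  the slopes depend only on \<open>A\<close> and \<open>C\<close>: the unknowns enter the constant
  terms alone, so slope times breakpoint is still linear. The second obstacle is minus infinity: it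
  absorbs under addition, while arguments with minimal solutions rest on subtraction. Hence a vector
  is split into its support and its integer entries.\<close>

definition nat_span :: "'a::comm_monoid_add set \<Rightarrow> 'a set" where
  "nat_span P = {\<Sum>\<^sub># M |M. set_mset M \<subseteq> P}"

definition linear_set :: "'a::comm_monoid_add \<Rightarrow> 'a set \<Rightarrow> 'a set" where
  "linear_set u P = (\<lambda>x. u + x) ` nat_span P"

lemma nat_spanI: "set_mset M \<subseteq> P \<Longrightarrow> \<Sum>\<^sub># M \<in> nat_span P"
  by (auto simp: nat_span_def)

lemma zero_in_nat_span: "0 \<in> nat_span P"
  using nat_spanI[of "{#}" P] by simp

lemma nat_span_incl: "p \<in> P \<Longrightarrow> p \<in> nat_span P"
  using nat_spanI[of "{#p#}" P] by simp

lemma nat_span_add: "x \<in> nat_span P \<Longrightarrow> y \<in> nat_span P \<Longrightarrow> x + y \<in> nat_span P"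
proof -
  assume "x \<in> nat_span P" "y \<in> nat_span P"
  then obtain M N where "x = \<Sum>\<^sub># M" "y = \<Sum>\<^sub># N" "set_mset M \<subseteq> P" "set_mset N \<subseteq> P"
    by (auto simp: nat_span_def)
  then show ?thesis
    using nat_spanI[of "M + N" P] by simp
qed

lemma nat_span_induct [consumes 1, case_names zero add]:
  assumes "x \<in> nat_span P" "Q 0" "\<And>p y. p \<in> P \<Longrightarrow> y \<in> nat_span P \<Longrightarrow> Q y \<Longrightarrow> Q (p + y)"
  shows "Q x"
proof -
  obtain M where "x = \<Sum>\<^sub># M" "set_mset M \<subseteq> P"
    using assms(1) by (auto simp: nat_span_def)
  moreover have "set_mset M \<subseteq> P \<Longrightarrow> Q (\<Sum>\<^sub># M)" for M
    by (induction M) (auto intro: assms nat_spanI)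
  ultimately show ?thesis by simp
qed

lemma nat_span_mono: "P \<subseteq> Q \<Longrightarrow> nat_span P \<subseteq> nat_span Q"
  by (force simp: nat_span_def)

lemma nat_span_Un: "nat_span (P \<union> Q) = nat_span P + nat_span Q"
proof
  show "nat_span (P \<union> Q) \<subseteq> nat_span P + nat_span Q"
  proof
    fix x assume "x \<in> nat_span (P \<union> Q)"
    then show "x \<in> nat_span P + nat_span Q"
    proof (induction rule: nat_span_induct)
      case zero
      then show ?case using set_plus_intro[OF zero_in_nat_span zero_in_nat_span, of P Q] by simp
    next
      case (add p y)
      then obtain a b where ab: "y = a + b" "a \<in> nat_span P" "b \<in> nat_span Q"
        by (auto elim: set_plus_elim)
      from add.hyps(1) show ?case
      proof
        assume "p \<in> P"
        then have "(p + a) + b \<in> nat_span P + nat_span Q"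
          by (intro set_plus_intro nat_span_add nat_span_incl ab)
        then show ?thesis by (simp add: ab add.assoc)
      next
        assume "p \<in> Q"
        then have "a + (p + b) \<in> nat_span P + nat_span Q"
          by (intro set_plus_intro nat_span_add nat_span_incl ab)
        then show ?thesis by (simp add: ab ac_simps)
      qed
    qed
  qed
  show "nat_span P + nat_span Q \<subseteq> nat_span (P \<union> Q)"
    using nat_span_mono[of P "P \<union> Q"] nat_span_mono[of Q "P \<union> Q"]
    by (auto elim!: set_plus_elim intro: nat_span_add)
qed

lemma linear_set_plus: "linear_set u P + linear_set v Q = linear_set (u + v) (P \<union> Q)"
  unfolding linear_set_def nat_span_Un
  by (force simp: set_plus_def ac_simps image_iff)

text \<open>In a nonempty sum of elements of \<open>u + nat_span P\<close>, one copy of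
  \<open>u\<close> is the base and the other copies become a period. Conversely, all periods from
  \<open>P\<close> can be absorbed by a single summand.\<close>

lemma nat_span_linear_set:
  "nat_span (linear_set u P) = {0} \<union> linear_set u (insert u P)"
proof
  show "nat_span (linear_set u P) \<subseteq> {0} \<union> linear_set u (insert u P)"
  proof
    fix x assume "x \<in> nat_span (linear_set u P)"
    then show "x \<in> {0} \<union> linear_set u (insert u P)"
    proof (induction rule: nat_span_induct)
      case (add p y)
      then obtain a where a: "p = u + a" "a \<in> nat_span P"
        by (auto simp: linear_set_def)
      then have a': "a \<in> nat_span (insert u P)" using nat_span_mono[of P "insert u P"] by auto
      from add(3) show ?case
      proof
        assume "y \<in> linear_set u (insert u P)"
        then obtain b where b: "y = u + b" "b \<in> nat_span (insert u P)"
          by (auto simp: linear_set_def)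
        have "a + (u + b) \<in> nat_span (insert u P)"
          by (intro nat_span_add nat_span_incl a' b) simp
        then have "u + (a + (u + b)) \<in> linear_set u (insert u P)"
          unfolding linear_set_def by (rule imageI)
        then show ?thesis by (simp add: a b ac_simps)
      qed (use a a' in \<open>auto simp: linear_set_def\<close>)
    qed simp
  qed
  \<comment> \<open>One summand \<open>u + a\<close> is kept open. A period from \<open>P\<close> is
    absorbed into \<open>a\<close>; a further copy of \<open>u\<close> closes the open summand,
    moves it into \<open>z\<close> and opens a new one with \<open>a = 0\<close>.\<close>
  have "\<exists>a\<in>nat_span P. \<exists>z\<in>nat_span (linear_set u P). u + x = (u + a) + z"
    if "x \<in> nat_span (insert u P)" for x
    using that
  proof (induction rule: nat_span_induct)
    case zero
    show ?case
      using zero_in_nat_span by (intro bexI[of _ 0]) auto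
  next
    case (add p y)
    then obtain a z where az: "a \<in> nat_span P" "z \<in> nat_span (linear_set u P)" "u + y = u + a + z"
      by blast
    from add.hyps(1) show ?case
    proof
      assume "p = u"
      moreover have "u + a + z \<in> nat_span (linear_set u P)"
        using az by (intro nat_span_add[OF nat_span_incl]) (auto simp: linear_set_def)
      ultimately show ?thesis
        using az zero_in_nat_span by (intro bexI[of _ 0] bexI[of _ "u + a + z"]) auto
    next
      assume "p \<in> P"
      then have "p + a \<in> nat_span P" by (intro nat_span_add nat_span_incl az)
      moreover have "u + (p + y) = u + (p + a) + z" using az(3) by (metis add.assoc add.commute)
      ultimately show ?thesis using az(2) by blast
    qed
  qed
  then have "u + x \<in> nat_span (linear_set u P)" if "x \<in> nat_span (insert u P)" for x
    using that nat_span_add[OF nat_span_incl, of "u + _" "linear_set u P"]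
    by (fastforce simp: linear_set_def)
  then show "{0} \<union> linear_set u (insert u P) \<subseteq> nat_span (linear_set u P)"
    using zero_in_nat_span by (auto simp: linear_set_def)
qed


text \<open>\<open>T\<close> constrains the periods only, never the base \<open>u\<close>. It is
  \<open>UNIV\<close> except for walks, where it forces every period to have positive
  length.\<close>

inductive semilinear :: "'a::comm_monoid_add set \<Rightarrow> 'a set \<Rightarrow> bool" for T where
  empty: "semilinear T {}"
| linear: "finite P \<Longrightarrow> P \<subseteq> T \<Longrightarrow> semilinear T (linear_set u P)"
| union: "semilinear T X \<Longrightarrow> semilinear T Y \<Longrightarrow> semilinear T (X \<union> Y)"

lemma semilinear_singleton: "semilinear T {u}"
proof -
  have "nat_span {} = {0::'a}" by (auto simp: nat_span_def)
  then show ?thesis using semilinear.linear[of "{}" T u] by (simp add: linear_set_def)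
qed

lemma semilinear_nat_span_finite: "finite P \<Longrightarrow> P \<subseteq> T \<Longrightarrow> semilinear T (nat_span P)"
  using semilinear.linear[of P T 0] by (simp add: linear_set_def)

lemma semilinear_UN:
  "finite I \<Longrightarrow> (\<And>i. i \<in> I \<Longrightarrow> semilinear T (X i)) \<Longrightarrow> semilinear T (\<Union>i\<in>I. X i)"
  by (induction I rule: finite_induct) (auto intro: semilinear.intros)

lemma semilinear_finite: "finite X \<Longrightarrow> semilinear T X"
  using semilinear_UN[of X T "\<lambda>x. {x}"] by (simp add: semilinear_singleton)

lemma semilinear_plus:
  assumes "semilinear T X" "semilinear T Y"
  shows "semilinear T (X + Y)"
  using assms(1)
proof induction
  case (linear P u)
  show ?case using assms(2)
  proof induction
    case (linear Q v)
    then show ?case using \<open>finite P\<close> \<open>P \<subseteq> T\<close>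
      by (simp add: linear_set_plus semilinear.linear)
  qed (auto simp: set_plus_Un intro: semilinear.intros)
qed (auto simp: Un_set_plus intro: semilinear.intros)

text \<open>The star turns the base of a linear set into a period, which is why \<open>X\<close>
  itself has to lie in \<open>T\<close>.\<close>

lemma semilinear_nat_span: "semilinear T X \<Longrightarrow> X \<subseteq> T \<Longrightarrow> semilinear T (nat_span X)"
proof (induction rule: semilinear.induct)
  case empty
  show ?case by (rule semilinear_nat_span_finite) auto
next
  case (linear P u)
  then have "u \<in> T" using zero_in_nat_span by (force simp: linear_set_def)
  then show ?case using linear unfolding nat_span_linear_set
    by (intro semilinear.union semilinear_singleton semilinear.linear) auto
next
  case (union X Y)
  then show ?case by (simp add: nat_span_Un semilinear_plus)
qed

lemma additive_zero:
  assumes "\<And>x y. h (x + y) = h x + (h y :: 'b::cancel_comm_monoid_add)"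
  shows "h (0 :: 'a::comm_monoid_add) = 0"
  using assms[of 0 0] by (simp only: add_0_left) (metis add_cancel_right_right)

lemma additive_nat_span:
  assumes "\<And>x y. h (x + y) = h x + h y" "h 0 = 0"
  shows "h ` nat_span P = nat_span (h ` P)"
proof -
  have h: "h (\<Sum>\<^sub># M) = \<Sum>\<^sub># (image_mset h M)" for M
    by (induction M) (auto simp: assms)
  show ?thesis
  proof
    show "h ` nat_span P \<subseteq> nat_span (h ` P)"
      by (auto simp: h nat_span_def[of P] intro!: nat_spanI imageI) blast
    show "nat_span (h ` P) \<subseteq> h ` nat_span P"
    proof
      fix y assume "y \<in> nat_span (h ` P)"
      then show "y \<in> h ` nat_span P"
      proof (induction rule: nat_span_induct)
        case zero
        then show ?case using zero_in_nat_span assms(2) by (metis imageI)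
      next
        case (add p y)
        then obtain q x where "q \<in> P" "p = h q" "x \<in> nat_span P" "y = h x" by auto
        then have "p + y = h (q + x)" "q + x \<in> nat_span P"
          by (auto simp: assms nat_span_add nat_span_incl)
        then show ?case by blast
      qed
    qed
  qed
qed

lemma semilinear_image:
  assumes "semilinear T X" "\<And>x y. h (x + y) = h x + h y" "h 0 = 0"
  shows "semilinear UNIV (h ` X)"
  using assms(1)
proof induction
  case (linear P u)
  have "h ` linear_set u P = linear_set (h u) (h ` P)"
    unfolding linear_set_def additive_nat_span[of h, OF assms(2,3), symmetric]
    by (auto simp: image_image assms(2))
  then show ?case using linear by (simp add: semilinear.linear)
qed (auto simp: image_Un intro: semilinear.intros)

lemma semilinear_translate: "semilinear T X \<Longrightarrow> semilinear T ((\<lambda>x. u + x) ` X)"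
  using semilinear_plus[OF semilinear_singleton, of T X u] insert_set_plus[of u "{}" X] by simp

section \<open>Dickson's lemma\<close>

lemma nat_seq_mono_subseq:
  fixes s :: "nat \<Rightarrow> nat"
  obtains g :: "nat \<Rightarrow> nat" where "strict_mono g" "mono (s \<circ> g)"
proof -
  obtain g where g: "strict_mono (g :: nat \<Rightarrow> nat)" "monoseq (\<lambda>n. s (g n))"
    using seq_monosub[of s] by auto
  show ?thesis
  proof (cases "incseq (\<lambda>n. s (g n))")
    case True
    then show ?thesis using that[of g] g by (simp add: comp_def)
  next
    case False
    then have dec: "s (g n) \<le> s (g m)" if "m \<le> n" for m n
      using g(2) that by (auto simp: monoseq_iff decseq_def)
    \<comment> \<open>A decreasing sequence of naturals is constant from the index where it attains
      its minimum.\<close>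
    obtain N where N: "\<And>n. s (g N) \<le> s (g n)"
      using ex_has_least_nat[of "\<lambda>_. True" 0 "\<lambda>n. s (g n)"] by auto
    have "s (g (n + N)) = s (g N)" for n
      using dec[of N "n + N"] N[of "n + N"] by simp
    moreover have "strict_mono (\<lambda>n. g (n + N))"
      using g(1) by (auto simp: strict_mono_def)
    ultimately show ?thesis using that[of "\<lambda>n. g (n + N)"] by (simp add: mono_def comp_def)
  qed
qed

lemma mset_seq_mono_subseq:
  fixes f :: "nat \<Rightarrow> 'i multiset"
  assumes "finite I"
  shows "\<exists>g :: nat \<Rightarrow> nat. strict_mono g \<and> (\<forall>i\<in>I. mono (\<lambda>n. count (f (g n)) i))"
  using assms
proof (induction I rule: finite_induct)
  case empty
  then show ?case by (auto intro: exI[of _ id] simp: strict_mono_def)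
next
  case (insert i I)
  then obtain g :: "nat \<Rightarrow> nat" where g: "strict_mono g" "\<forall>j\<in>I. mono (\<lambda>n. count (f (g n)) j)"
    by blast
  obtain g' :: "nat \<Rightarrow> nat" where g': "strict_mono g'" "mono ((\<lambda>n. count (f (g n)) i) \<circ> g')"
    by (rule nat_seq_mono_subseq)
  have m: "mono g'" using g'(1) by (rule strict_mono_mono)
  show ?case
  proof (intro exI[of _ "g \<circ> g'"] conjI ballI)
    show "strict_mono (g \<circ> g')" using g(1) g'(1) by (auto simp: strict_mono_def)
    fix j assume j: "j \<in> insert i I"
    show "mono (\<lambda>n. count (f ((g \<circ> g') n)) j)"
    proof (cases "j = i")
      case True
      then show ?thesis using g'(2) by (simp add: comp_def)
    next
      case False
      then have "mono (\<lambda>n. count (f (g n)) j)" using j g(2) by auto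
      then show ?thesis using m by (simp add: mono_def)
    qed
  qed
qed

text \<open>Multisets over \<open>I\<close> are vectors of multiplicities. \<open>B\<close> consists
  of the minimal elements; an infinite sequence of them would have a subsequence increasing in every
  coordinate, so two would be comparable. Descent on the size finds a minimal element below any
  given one.\<close>

lemma dickson:
  fixes Z :: "'i multiset set"
  assumes "finite I" "\<And>M. M \<in> Z \<Longrightarrow> set_mset M \<subseteq> I"
  obtains B where "finite B" "B \<subseteq> Z" "\<And>M. M \<in> Z \<Longrightarrow> \<exists>N\<in>B. N \<subseteq># M"
proof -
  define B where "B = {N \<in> Z. \<forall>M\<in>Z. \<not> M \<subset># N}"
  have "finite B"
  proof (rule ccontr)
    assume "infinite B"
    then obtain f :: "nat \<Rightarrow> 'i multiset" where f: "inj f" "range f \<subseteq> B"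
      using infinite_countable_subset by blast
    obtain g :: "nat \<Rightarrow> nat" where g: "strict_mono g" "\<And>i. i \<in> I \<Longrightarrow> mono (\<lambda>n. count (f (g n)) i)"
      using mset_seq_mono_subseq[OF assms(1), of f] by blast
    have B: "f (g n) \<in> B" for n using f(2) by auto
    have "count (f (g 0)) i \<le> count (f (g 1)) i" for i
    proof (cases "i \<in> I")
      case True
      then show ?thesis using monoD[OF g(2)[OF True], of 0 1] by simp
    next
      case False
      then have "i \<notin># f (g 0)" using assms(2)[of "f (g 0)"] B[of 0] by (auto simp: B_def)
      then show ?thesis by (simp add: not_in_iff)
    qed
    then have "f (g 0) \<subseteq># f (g 1)" by (simp add: mset_subset_eqI)
    moreover have "f (g 0) \<noteq> f (g 1)"
      using f(1) strict_monoD[OF g(1), of 0 1] by (metis injD less_numeral_extra(1) order_less_irrefl)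
    ultimately have "f (g 0) \<subset># f (g 1)" by (simp add: subset_mset.less_le)
    then show False using B[of 0] B[of 1] by (auto simp: B_def)
  qed
  moreover have "\<exists>N\<in>B. N \<subseteq># M" if "M \<in> Z" for M
    using that
  proof (induction "size M" arbitrary: M rule: less_induct)
    case less
    show ?case
    proof (cases "M \<in> B")
      case False
      then obtain N where N: "N \<in> Z" "N \<subset># M" using less.prems by (auto simp: B_def)
      then obtain N' where "N' \<in> B" "N' \<subseteq># N" using less.hyps mset_subset_size by blast
      then show ?thesis using N by (meson subset_mset.dual_order.trans subset_mset.less_imp_le)
    qed auto
  qed
  ultimately show ?thesis using that[of B] by (auto simp: B_def)
qed

section \<open>Linear equations in multiplicities, and intersections with preimages\<close>

text \<open>The bases are the minimal solutions, the periods the minimal nonzero solutions of the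
  homogeneous equation. Subtracting a smaller solution leaves a homogeneous one by cancellation, and
  excluding \<open>{#}\<close> from \<open>Z0\<close> makes repeated subtraction terminate.\<close>

lemma semilinear_mset_equation:
  fixes \<phi> :: "'i multiset \<Rightarrow> 'g::cancel_comm_monoid_add"
  assumes "finite I" and add: "\<And>M N. \<phi> (M + N) = \<phi> M + \<phi> N"
  shows "semilinear UNIV {M. set_mset M \<subseteq> I \<and> \<phi> M = c}"
proof -
  define Z where "Z = {M. set_mset M \<subseteq> I \<and> \<phi> M = c}"
  define Z0 where "Z0 = {M. set_mset M \<subseteq> I \<and> M \<noteq> {#} \<and> \<phi> M = 0}"
  obtain B where B: "finite B" "B \<subseteq> Z" "\<And>M. M \<in> Z \<Longrightarrow> \<exists>N\<in>B. N \<subseteq># M"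
    by (rule dickson[OF assms(1), of Z]) (simp add: Z_def, blast)
  obtain H where H: "finite H" "H \<subseteq> Z0" "\<And>M. M \<in> Z0 \<Longrightarrow> \<exists>N\<in>H. N \<subseteq># M"
    by (rule dickson[OF assms(1), of Z0]) (simp add: Z0_def, blast)
  have hom: "M \<in> nat_span H" if "set_mset M \<subseteq> I" "\<phi> M = 0" for M
    using that
  proof (induction "size M" arbitrary: M rule: less_induct)
    case less
    show ?case
    proof (cases "M = {#}")
      case False
      then obtain N where N: "N \<in> H" "N \<subseteq># M" using H(3)[of M] less.prems by (auto simp: Z0_def)
      then obtain M' where M': "M = N + M'" by (metis subset_mset.le_iff_add)
      have "N \<noteq> {#}" "\<phi> N = 0" using N H(2) by (auto simp: Z0_def)
      then have "size M' < size M" "\<phi> M' = 0"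
        using less.prems M' by (auto simp: add nonempty_has_size[symmetric])
      then have "M' \<in> nat_span H" using less M' by auto
      then show ?thesis unfolding M' by (rule nat_span_add[OF nat_span_incl[OF N(1)]])
    qed (auto intro: zero_in_nat_span[of H, simplified])
  qed
  have hom': "set_mset M \<subseteq> I \<and> \<phi> M = 0" if "M \<in> nat_span H" for M
    using that
  proof (induction rule: nat_span_induct)
    case zero
    then show ?case using additive_zero[of \<phi>, OF add] by simp
  next
    case (add p y)
    then show ?case using H(2) assms(2) by (auto simp: Z0_def)
  qed
  have "{M. set_mset M \<subseteq> I \<and> \<phi> M = c} = (\<Union>N\<in>B. linear_set N H)"
    unfolding Z_def[symmetric]
  proof (intro equalityI subsetI)
    fix M assume M: "M \<in> Z"
    then obtain N where N: "N \<in> B" "N \<subseteq># M" using B(3) by blast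
    then obtain M' where M': "M = N + M'" by (metis subset_mset.le_iff_add)
    have "\<phi> N = c" using N B(2) by (auto simp: Z_def)
    then have "\<phi> M' = 0" using M M' add by (simp add: Z_def)
    then have "M' \<in> nat_span H" using M M' hom by (auto simp: Z_def)
    then show "M \<in> (\<Union>N\<in>B. linear_set N H)" using N M' by (auto simp: linear_set_def)
  next
    fix M assume "M \<in> (\<Union>N\<in>B. linear_set N H)"
    then obtain N M' where "N \<in> B" "M' \<in> nat_span H" "M = N + M'"
      by (auto simp: linear_set_def)
    then show "M \<in> Z"
      using B(2) hom'[of M'] by (auto simp: add Z_def)
  qed
  then show ?thesis using B H by (auto intro!: semilinear_UN semilinear.linear)
qed

text \<open>For linear sets, membership of \<open>h x\<close> is an equation between the
  multiplicities of the periods on both sides; its solutions are then projected to the periods of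
  \<open>S\<close>.\<close>

lemma semilinear_Int_vimage:
  fixes h :: "'a::comm_monoid_add \<Rightarrow> 'b::ab_group_add"
  assumes S: "semilinear T S" and R: "semilinear T' R"
    and h: "\<And>x y. h (x + y) = h x + h y"
  shows "semilinear UNIV {x \<in> S. h x \<in> R}"
  using S
proof induction
  case empty
  show ?case by (simp add: semilinear.empty)
next
  case (union X Y)
  have "{x \<in> X \<union> Y. h x \<in> R} = {x \<in> X. h x \<in> R} \<union> {x \<in> Y. h x \<in> R}" by auto
  with union show ?case by (simp add: semilinear.union)
next
  case (linear P u)
  show ?case using R
  proof induction
    case empty
    show ?case by (simp add: semilinear.empty)
  next
    case (union X Y)
    have "{x \<in> linear_set u P. h x \<in> X \<union> Y} =
        {x \<in> linear_set u P. h x \<in> X} \<union> {x \<in> linear_set u P. h x \<in> Y}" by auto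
    with union show ?case by (simp add: semilinear.union)
  next
    case lin: (linear Q v)
    \<comment> \<open>The tagged union keeps the multiplicities of \<open>P\<close> and
      \<open>Q\<close> apart. \<open>\<phi>\<close> moves the \<open>Q\<close> part to the other
      side of the equation, for which the target must be a group; \<open>\<psi>\<close> forgets
      it.\<close>
    define I where "I = Inl ` P \<union> Inr ` Q"
    define \<phi> where "\<phi> M = (\<Sum>i\<in>#M. case i of Inl p \<Rightarrow> h p | Inr q \<Rightarrow> - q)" for M :: "('a + 'b) multiset"
    define \<psi> where "\<psi> M = (\<Sum>i\<in>#M. case i of Inl p \<Rightarrow> p | Inr q \<Rightarrow> 0)" for M :: "('a + 'b) multiset"
    have h0: "h 0 = 0" by (rule additive_zero[of h, OF h])
    have split: "\<exists>K N. \<psi> M = \<Sum>\<^sub># K \<and> set_mset K \<subseteq> P \<and> set_mset N \<subseteq> Q \<and> \<phi> M = h (\<Sum>\<^sub># K) - \<Sum>\<^sub># N"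
      if "set_mset M \<subseteq> I" for M
      using that
    proof (induction M)
      case empty
      then show ?case by (intro exI[of _ "{#}"]) (auto simp: \<phi>_def \<psi>_def h0)
    next
      case (add i M)
      then obtain K N where KN: "\<psi> M = \<Sum>\<^sub># K" "set_mset K \<subseteq> P" "set_mset N \<subseteq> Q"
        "\<phi> M = h (\<Sum>\<^sub># K) - \<Sum>\<^sub># N" by auto
      show ?case
      proof (cases i)
        case (Inl p)
        then have "p \<in> P" using add.prems by (auto simp: I_def)
        then show ?thesis using KN Inl
          by (intro exI[of _ "add_mset p K"] exI[of _ N]) (auto simp: \<phi>_def \<psi>_def h)
      next
        case (Inr q)
        then have "q \<in> Q" using add.prems by (auto simp: I_def)
        then show ?thesis using KN Inr
          by (intro exI[of _ K] exI[of _ "add_mset q N"]) (auto simp: \<phi>_def \<psi>_def)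
      qed
    qed
    have join: "\<exists>M. set_mset M \<subseteq> I \<and> \<psi> M = \<Sum>\<^sub># K \<and> \<phi> M = h (\<Sum>\<^sub># K) - \<Sum>\<^sub># N"
      if "set_mset K \<subseteq> P" "set_mset N \<subseteq> Q" for K N
    proof (intro exI conjI)
      let ?M = "image_mset Inl K + image_mset Inr N"
      show "set_mset ?M \<subseteq> I" using that by (auto simp: I_def)
      have hs: "h (\<Sum>\<^sub># K) = \<Sum>\<^sub># (image_mset h K)" by (induction K) (auto simp: h h0)
      have ns: "\<Sum>\<^sub># (image_mset uminus N) = - \<Sum>\<^sub># N" by (induction N) auto
      have "\<psi> ?M = \<Sum>\<^sub># K" "\<phi> ?M = \<Sum>\<^sub># (image_mset h K) + \<Sum>\<^sub># (image_mset uminus N)"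
        by (auto simp: \<psi>_def \<phi>_def multiset.map_comp comp_def)
      then show "\<psi> ?M = \<Sum>\<^sub># K" "\<phi> ?M = h (\<Sum>\<^sub># K) - \<Sum>\<^sub># N" by (auto simp: hs ns)
    qed
    have "{x \<in> linear_set u P. h x \<in> linear_set v Q} =
        (\<lambda>x. u + x) ` \<psi> ` {M. set_mset M \<subseteq> I \<and> \<phi> M = v - h u}" (is "?L = ?R")
    proof (intro equalityI subsetI)
      fix x assume "x \<in> ?L"
      then obtain K N where KN: "x = u + \<Sum>\<^sub># K" "set_mset K \<subseteq> P" "set_mset N \<subseteq> Q" "h x = v + \<Sum>\<^sub># N"
        by (auto simp: linear_set_def nat_span_def)
      obtain M where M: "set_mset M \<subseteq> I" "\<psi> M = \<Sum>\<^sub># K" "\<phi> M = h (\<Sum>\<^sub># K) - \<Sum>\<^sub># N"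
        using join KN by blast
      have "h u + h (\<Sum>\<^sub># K) = v + \<Sum>\<^sub># N" using KN(4) by (simp add: KN(1) h)
      then have "\<phi> M = v - h u" unfolding M(3) by (simp add: algebra_simps)
      with M(1) have "\<psi> M \<in> \<psi> ` {M. set_mset M \<subseteq> I \<and> \<phi> M = v - h u}" by simp
      then show "x \<in> ?R" unfolding KN(1) M(2)[symmetric] by (rule imageI)
    next
      fix x assume "x \<in> ?R"
      then obtain M where M: "set_mset M \<subseteq> I" "\<phi> M = v - h u" "x = u + \<psi> M" by auto
      obtain K N where KN: "\<psi> M = \<Sum>\<^sub># K" "set_mset K \<subseteq> P" "set_mset N \<subseteq> Q" "\<phi> M = h (\<Sum>\<^sub># K) - \<Sum>\<^sub># N"
        using split M(1) by blast
      have "h (\<Sum>\<^sub># K) - \<Sum>\<^sub># N = v - h u" using M(2) KN(4) by simp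
      then have "h x = v + \<Sum>\<^sub># N" unfolding M(3) KN(1) h by (simp add: algebra_simps)
      then show "x \<in> ?L" using M KN by (auto simp: linear_set_def nat_spanI)
    qed
    moreover have "semilinear UNIV (\<psi> ` {M. set_mset M \<subseteq> I \<and> \<phi> M = v - h u})"
    proof (rule semilinear_image[OF semilinear_mset_equation])
      show "finite I" using linear lin by (simp add: I_def)
    qed (auto simp: \<phi>_def \<psi>_def)
    ultimately show ?case by (simp add: semilinear_translate)
  qed
qed

section \<open>Ultimately affine maxima\<close>

text \<open>A value in \<int> with minus infinity is represented by the set of integers below it, so
  maximum becomes union and an empty \<open>F\<close> means minus infinity. Keeping a maximum
  instead of its eventually dominant term gives closure under union without raising the
  threshold.\<close>

definition affine_max :: "(nat \<Rightarrow> int set) \<Rightarrow> bool" where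
  "affine_max t \<longleftrightarrow>
     (\<exists>F. finite F \<and> (\<forall>p. t p = {w. \<exists>(a, l)\<in>F. w \<le> a + l * int p}))"

text \<open>Every start \<open>k \<ge> K\<close> is included, not just one per residue class, so
  that \<open>K\<close> can be raised and \<open>D\<close> replaced by a multiple when several
  functions are brought to common constants.\<close>

definition affine_max_from :: "nat \<Rightarrow> nat \<Rightarrow> (nat \<Rightarrow> int set) \<Rightarrow> bool" where
  "affine_max_from K D t \<longleftrightarrow> (\<forall>k\<ge>K. affine_max (\<lambda>p. t (k + D * p)))"

lemma affine_max_empty: "affine_max (\<lambda>_. {})"
  by (auto simp: affine_max_def intro: exI[of _ "{}"])

lemma affine_max_Un: "affine_max s \<Longrightarrow> affine_max t \<Longrightarrow> affine_max (\<lambda>p. s p \<union> t p)"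
  unfolding affine_max_def
proof (elim exE conjE)
  fix F G
  assume "finite F" "\<forall>p. s p = {w. \<exists>(a, l)\<in>F. w \<le> a + l * int p}"
    "finite G" "\<forall>p. t p = {w. \<exists>(a, l)\<in>G. w \<le> a + l * int p}"
  then show "\<exists>F. finite F \<and> (\<forall>p. s p \<union> t p = {w. \<exists>(a, l)\<in>F. w \<le> a + l * int p})"
    by (intro exI[of _ "F \<union> G"]) auto
qed

lemma affine_max_translate: "affine_max t \<Longrightarrow> affine_max (\<lambda>p. (\<lambda>w. c + w) ` t p)"
  unfolding affine_max_def
proof (elim exE conjE)
  fix F
  assume F: "finite F" "\<forall>p. t p = {w. \<exists>(a, l)\<in>F. w \<le> a + l * int p}"
  have "(\<lambda>w. c + w) ` t p = {w. \<exists>(a, l)\<in>(\<lambda>(a, l). (c + a, l)) ` F. w \<le> a + l * int p}" for p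
  proof (intro equalityI subsetI)
    fix w assume "w \<in> {w. \<exists>(a, l)\<in>(\<lambda>(a, l). (c + a, l)) ` F. w \<le> a + l * int p}"
    then have "w - c \<in> t p" using F(2) by force
    then show "w \<in> (\<lambda>w. c + w) ` t p" by (force intro: image_eqI[of _ _ "w - c"])
  qed (use F in force)
  then show "\<exists>F. finite F \<and> (\<forall>p. (\<lambda>w. c + w) ` t p = {w. \<exists>(a, l)\<in>F. w \<le> a + l * int p})"
    using F(1) by blast
qed

lemma affine_max_reindex: "affine_max t \<Longrightarrow> affine_max (\<lambda>p. t (c + e * p))"
  unfolding affine_max_def
proof (elim exE conjE)
  fix F
  assume F: "finite F" "\<forall>p. t p = {w. \<exists>(a, l)\<in>F. w \<le> a + l * int p}"
  show "\<exists>F. finite F \<and> (\<forall>p. t (c + e * p) = {w. \<exists>(a, l)\<in>F. w \<le> a + l * int p})"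
    using F by (intro exI[of _ "(\<lambda>(a, l). (a + l * int c, l * int e)) ` F"])
      (auto simp: algebra_simps split_beta)
qed

lemma affine_max_from_weaken:
  assumes "affine_max_from K D t" "K \<le> K'" "D dvd D'"
  shows "affine_max_from K' D' t"
  unfolding affine_max_from_def
proof (intro allI impI)
  fix k assume "K' \<le> k"
  obtain e where e: "D' = D * e" using assms(3) by auto
  have "affine_max (\<lambda>p. t (k + D * p))"
    using assms \<open>K' \<le> k\<close> by (auto simp: affine_max_from_def)
  from affine_max_reindex[OF this, of 0 e] show "affine_max (\<lambda>p. t (k + D' * p))"
    by (simp add: e mult.assoc)
qed

lemma affine_max_from_family:
  assumes "finite I" "\<And>i. i \<in> I \<Longrightarrow> \<exists>K D. 0 < D \<and> affine_max_from K D (t i)"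
  shows "\<exists>K D. 0 < D \<and> (\<forall>i\<in>I. affine_max_from K D (t i))"
  using assms
proof (induction I rule: finite_induct)
  case (insert i I)
  obtain K D where KD: "0 < D" "affine_max_from K D (t i)" using insert.prems by blast
  obtain K' D' where KD': "0 < D'" "\<forall>i\<in>I. affine_max_from K' D' (t i)"
    using insert by blast
  show ?case
  proof (intro exI conjI ballI)
    show "0 < D * D'" using KD KD' by simp
    fix j assume "j \<in> insert i I"
    then show "affine_max_from (max K K') (D * D') (t j)"
      using affine_max_from_weaken[OF KD(2), of "max K K'" "D * D'"]
        affine_max_from_weaken[of K' D' "t j" "max K K'" "D * D'"] KD'(2) by auto
  qed
qed auto

definition ultimately_affine :: "(nat \<Rightarrow> int set) \<Rightarrow> bool" where
  "ultimately_affine t \<longleftrightarrow> (\<exists>K D. 0 < D \<and> affine_max_from K D t)"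

lemma ultimately_affine_cong:
  assumes "ultimately_affine s" "\<And>k. k \<ge> N \<Longrightarrow> t k = s k"
  shows "ultimately_affine t"
proof -
  obtain K D where "0 < D" "affine_max_from K D s"
    using assms(1) by (auto simp: ultimately_affine_def)
  then have "affine_max_from (max K N) D s" by (auto intro: affine_max_from_weaken)
  then have "affine_max_from (max K N) D t"
    by (simp add: affine_max_from_def assms(2))
  with \<open>0 < D\<close> show ?thesis by (auto simp: ultimately_affine_def)
qed

lemma ultimately_affine_empty: "ultimately_affine (\<lambda>_. {})"
  by (auto simp: ultimately_affine_def affine_max_from_def affine_max_empty)

lemma ultimately_affine_Un:
  assumes "ultimately_affine s" "ultimately_affine t"
  shows "ultimately_affine (\<lambda>k. s k \<union> t k)"
proof -
  have "\<exists>K D. 0 < D \<and> (\<forall>i\<in>{True, False}. affine_max_from K D (if i then s else t))"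
    using assms by (intro affine_max_from_family) (auto simp: ultimately_affine_def)
  then obtain K D where "0 < D" "affine_max_from K D s" "affine_max_from K D t" by auto
  moreover from this(2,3) have "affine_max_from K D (\<lambda>k. s k \<union> t k)"
    unfolding affine_max_from_def by (intro allI impI affine_max_Un) simp_all
  ultimately show ?thesis unfolding ultimately_affine_def by blast
qed

lemma ultimately_affine_UN:
  "finite I \<Longrightarrow> (\<And>i. i \<in> I \<Longrightarrow> ultimately_affine (t i)) \<Longrightarrow> ultimately_affine (\<lambda>k. \<Union>i\<in>I. t i k)"
  by (induction I rule: finite_induct) (auto intro: ultimately_affine_empty ultimately_affine_Un)

lemma ultimately_affine_translate:
  "ultimately_affine t \<Longrightarrow> ultimately_affine (\<lambda>k. (\<lambda>w. c + w) ` t k)"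
  unfolding ultimately_affine_def affine_max_from_def
proof (elim exE conjE)
  fix K D :: nat
  assume "0 < D" "\<forall>k\<ge>K. affine_max (\<lambda>p. t (k + D * p))"
  then show "\<exists>K D. 0 < D \<and> (\<forall>k\<ge>K. affine_max (\<lambda>p. (\<lambda>w. c + w) ` t (k + D * p)))"
    by (intro exI[of _ K] exI[of _ D] conjI allI impI affine_max_translate) simp_all
qed

section \<open>Greatest weights by length in a semilinear set of pairs\<close>

text \<open>Closing downwards discards all but the greatest weight at length \<open>k\<close>, which
  is all that a max-plus matrix power sees.\<close>

definition level :: "(nat \<times> int) set \<Rightarrow> nat \<Rightarrow> int set" where
  "level X k = {w. \<exists>w'\<ge>w. (k, w') \<in> X}"

lemma level_Un: "level (X \<union> Y) k = level X k \<union> level Y k"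
  by (auto simp: level_def)

lemma sum_mset_replicate_pair:
  "\<Sum>\<^sub># (replicate_mset j p) = (j * fst p, int j * snd p)" for p :: "nat \<times> int"
  by (induction j) (auto simp: zero_prod_def algebra_simps prod_eq_iff)

text \<open>With one period, a length is attained exactly when it is at least \<open>fst u\<close>
  and congruent to it modulo \<open>fst q\<close>; it then determines the number of copies of
  \<open>q\<close>, and each step by \<open>fst q\<close> adds \<open>snd q\<close> to the
  weight.\<close>

lemma ultimately_affine_line:
  fixes u q :: "nat \<times> int"
  assumes "0 < fst q"
  shows "ultimately_affine (level (linear_set u {q}))"
proof -
  have span: "nat_span {q} = range (\<lambda>n. (n * fst q, int n * snd q))"
  proof (intro equalityI subsetI)
    fix x assume "x \<in> nat_span {q}"
    then obtain M where M: "x = \<Sum>\<^sub># M" "set_mset M \<subseteq> {q}" by (auto simp: nat_span_def)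
    then have "M = replicate_mset (size M) q" by (simp add: set_mset_subset_singletonD)
    with M(1) have "x = (size M * fst q, int (size M) * snd q)"
      by (metis sum_mset_replicate_pair)
    then show "x \<in> range (\<lambda>n. (n * fst q, int n * snd q))" by blast
  next
    fix x assume "x \<in> range (\<lambda>n. (n * fst q, int n * snd q))"
    then obtain n where "x = \<Sum>\<^sub># (replicate_mset n q)" by (auto simp: sum_mset_replicate_pair)
    moreover have "set_mset (replicate_mset n q) \<subseteq> {q}" by auto
    ultimately show "x \<in> nat_span {q}" using nat_spanI by blast
  qed
  have "linear_set u {q} = range (\<lambda>n. (fst u + n * fst q, snd u + int n * snd q))"
    by (cases u) (simp add: linear_set_def span image_image)
  then have lev: "level (linear_set u {q}) k =
      {w. \<exists>n. k = fst u + n * fst q \<and> w \<le> snd u + int n * snd q}" for k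
    by (auto simp: level_def)
  have "affine_max_from (fst u) (fst q) (level (linear_set u {q}))"
    unfolding affine_max_from_def
  proof (intro allI impI)
    fix k assume k: "fst u \<le> k"
    show "affine_max (\<lambda>p. level (linear_set u {q}) (k + fst q * p))"
    proof (cases "fst q dvd k - fst u")
      case True
      then obtain m where m: "k = fst u + m * fst q"
        using k by (metis dvd_div_mult_self le_add_diff_inverse)
      have "fst u + m * fst q + fst q * p = fst u + n * fst q \<longleftrightarrow> n = m + p" for n p
      proof -
        have "fst u + m * fst q + fst q * p = fst u + (m + p) * fst q" by (simp add: algebra_simps)
        then show ?thesis using assms by auto
      qed
      then have eq: "k + fst q * p = fst u + n * fst q \<longleftrightarrow> n = m + p" for n p
        by (simp only: m)
      have "level (linear_set u {q}) (k + fst q * p) =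
          {w. \<exists>(a, l)\<in>{(snd u + int m * snd q, snd q)}. w \<le> a + l * int p}" for p
        unfolding lev eq by (simp add: algebra_simps)
      then show ?thesis unfolding affine_max_def by blast
    next
      case False
      have "k + fst q * p \<noteq> fst u + n * fst q" for n p
      proof
        assume "k + fst q * p = fst u + n * fst q"
        then have "k - fst u + fst q * p = n * fst q" using k by linarith
        then show False using False by (metis dvd_add_left_iff dvd_triv_left dvd_triv_right)
      qed
      then show ?thesis by (simp add: lev affine_max_empty)
    qed
  qed
  then show ?thesis using assms by (auto simp: ultimately_affine_def)
qed

text \<open>Trading \<open>fst q\<close> copies of the period \<open>p\<close> for \<open>fst p\<close> copies of a period \<open>q\<close> of larger slope
  keeps the length and does not decrease the weight, so fewer than \<open>fst q\<close> copies of \<open>p\<close> suffice.\<close>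

lemma level_linear_set_exchange:
  fixes u p q :: "nat \<times> int"
  assumes pq: "p \<in> P" "q \<in> P" "p \<noteq> q" and q: "0 < fst q"
    and slope: "int (fst q) * snd p \<le> int (fst p) * snd q"
  shows "level (linear_set u P) k =
    (\<Union>j<fst q. level (linear_set (u + (j * fst p, int j * snd p)) (P - {p})) k)"
proof (intro equalityI subsetI)
  fix w assume "w \<in> level (linear_set u P) k"
  then obtain w' M where w': "w \<le> w'" "(k, w') = u + \<Sum>\<^sub># M" and M: "set_mset M \<subseteq> P"
    by (auto simp: level_def linear_set_def nat_span_def)
  define c where "c = count M p"
  define M' where "M' = filter_mset (\<lambda>x. x \<noteq> p) M"
  define j where "j = c mod fst q"
  define e where "e = c div fst q"
  have c: "c = e * fst q + j" by (simp add: e_def j_def)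
  have "M = M' + replicate_mset c p"
    by (rule multiset_eqI) (auto simp: M'_def c_def)
  then have sum: "\<Sum>\<^sub># M = \<Sum>\<^sub># M' + (c * fst p, int c * snd p)"
    by (simp add: sum_mset_replicate_pair)
  define y where "y = \<Sum>\<^sub># (M' + replicate_mset (e * fst p) q)"
  have y: "y = \<Sum>\<^sub># M' + (e * fst p * fst q, int (e * fst p) * snd q)"
    by (simp add: y_def sum_mset_replicate_pair)
  have "set_mset (M' + replicate_mset (e * fst p) q) \<subseteq> P - {p}"
    using M pq by (auto simp: M'_def)
  then have yP: "y \<in> nat_span (P - {p})" unfolding y_def by (rule nat_spanI)
  define w'' where "w'' = snd (u + (j * fst p, int j * snd p) + y)"
  have k: "k = fst (u + (j * fst p, int j * snd p) + y)"
    using arg_cong[OF w'(2), of fst] by (simp add: sum y c algebra_simps)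
  have "int e * (int (fst q) * snd p) \<le> int e * (int (fst p) * snd q)"
    using slope by (intro mult_left_mono) auto
  then have "w' \<le> w''"
    using arg_cong[OF w'(2), of snd] by (simp add: w''_def sum y c algebra_simps)
  moreover have "(k, w'') \<in> linear_set (u + (j * fst p, int j * snd p)) (P - {p})"
    unfolding linear_set_def k w''_def prod.collapse using yP by (rule imageI)
  moreover have "j < fst q" using q by (simp add: j_def)
  ultimately show "w \<in> (\<Union>j<fst q. level (linear_set (u + (j * fst p, int j * snd p)) (P - {p})) k)"
    using w'(1) by (auto simp: level_def intro!: bexI[of _ j] exI[of _ w''])
next
  fix w assume "w \<in> (\<Union>j<fst q. level (linear_set (u + (j * fst p, int j * snd p)) (P - {p})) k)"
  then obtain j w' M where j: "w \<le> w'" "(k, w') = u + (j * fst p, int j * snd p) + \<Sum>\<^sub># M"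
      "set_mset M \<subseteq> P - {p}"
    by (auto simp: level_def linear_set_def nat_span_def)
  then have "(k, w') = u + \<Sum>\<^sub># (replicate_mset j p + M)"
    by (simp add: sum_mset_replicate_pair add.assoc)
  moreover have "set_mset (replicate_mset j p + M) \<subseteq> P" using j pq by auto
  ultimately have "(k, w') \<in> linear_set u P"
    unfolding linear_set_def by (metis imageI nat_spanI)
  then show "w \<in> level (linear_set u P) k" using j(1) by (auto simp: level_def)
qed

text \<open>Of two periods, the one of smaller or equal slope is removed at the price of a finite
  union, until at most one is left. With no period only one length occurs, so the levels are
  eventually empty. Slopes are compared after cross multiplication, which is legitimate for positive
  lengths.\<close>

lemma ultimately_affine_linear_set:
  fixes P :: "(nat \<times> int) set"
  assumes "finite P" "\<And>p. p \<in> P \<Longrightarrow> 0 < fst p"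
  shows "ultimately_affine (level (linear_set u P))"
  using assms
proof (induction "card P" arbitrary: u P rule: less_induct)
  case less
  consider "P = {}" | q where "P = {q}" | p q where "p \<in> P" "q \<in> P" "p \<noteq> q"
    by blast
  then show ?case
  proof cases
    case 1
    then have "linear_set u P = {u}" by (auto simp: linear_set_def nat_span_def)
    then have "level (linear_set u P) k = {}" if "k \<ge> Suc (fst u)" for k
      using that by (cases u) (auto simp: level_def)
    then show ?thesis using ultimately_affine_cong[OF ultimately_affine_empty] by blast
  next
    case (2 q)
    then show ?thesis using less.prems by (auto intro: ultimately_affine_line)
  next
    case (3 p q)
    then obtain a b where ab: "a \<in> P" "b \<in> P" "a \<noteq> b" "int (fst b) * snd a \<le> int (fst a) * snd b"
      by (metis linorder_le_cases)
    have "ultimately_affine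
        (\<lambda>k. \<Union>j<fst b. level (linear_set (u + (j * fst a, int j * snd a)) (P - {a})) k)"
    proof (intro ultimately_affine_UN)
      fix j
      show "ultimately_affine (level (linear_set (u + (j * fst a, int j * snd a)) (P - {a})))"
        using less.prems ab by (intro less.hyps card_Diff1_less) auto
    qed auto
    then show ?thesis
      using level_linear_set_exchange[OF ab(1-3) _ ab(4), of u] less.prems(2)[OF ab(2)]
      by (auto intro: ultimately_affine_cong[where N = 0])
  qed
qed

lemma ultimately_affine_semilinear:
  "semilinear {x. 0 < fst x} X \<Longrightarrow> ultimately_affine (level X)"
proof (induction rule: semilinear.induct)
  case empty
  have "level {} = (\<lambda>_. {})" by (auto simp: level_def)
  then show ?case by (simp add: ultimately_affine_empty)
next
  case (linear P u)
  then show ?case by (intro ultimately_affine_linear_set) auto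
next
  case (union X Y)
  have "level (X \<union> Y) = (\<lambda>k. level X k \<union> level Y k)" by (auto simp: level_Un)
  with union show ?case by (simp add: ultimately_affine_Un)
qed

section \<open>Powers of max-plus matrices\<close>

text \<open>This encoding is injective, so equalities over \<open>zmax\<close> can be checked on
  sets; products become Minkowski sums.\<close>

definition below :: "zmax \<Rightarrow> int set" where
  "below z = {w. Fin w \<le> z}"

lemma below_simps [simp]: "below NegInf = {}" "below (Fin a) = {..a}"
  by (auto simp: below_def)

lemma below_inject: "below x = below y \<longleftrightarrow> x = y"
  by (cases x; cases y) auto

lemma below_plus [simp]: "below (x + y) = below x \<union> below y"
  by (auto simp: below_def plus_zmax_def le_max_iff_disj)

lemma below_zero [simp]: "below 0 = {}"
  by (simp add: zero_zmax_def)

lemma below_one [simp]: "below 1 = {..0}"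
  by (simp add: one_zmax_def)

lemma below_sum: "finite I \<Longrightarrow> below (sum f I) = (\<Union>i\<in>I. below (f i))"
  by (induction I rule: finite_induct) auto

lemma below_times: "below (x * y) = below x + below y"
proof (cases x; cases y)
  fix a b assume "x = Fin a" "y = Fin b"
  moreover have "w \<in> {..a} + {..b}" if "w \<le> a + b" for w
    using set_plus_intro[of a "{..a}" "w - a" "{..b}"] that by auto
  ultimately show ?thesis by (auto simp: set_plus_def)
qed auto

lemma below_Fin_times: "below (Fin c * y) = (\<lambda>w. c + w) ` below y"
  by (cases y) auto

lemma below_mult_mat:
  assumes "X \<in> carrier_mat m n" "Y \<in> carrier_mat n r" "i < m" "j < r"
  shows "below ((X * Y) $$ (i, j)) = (\<Union>l<n. below (X $$ (i, l)) + below (Y $$ (l, j)))"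
proof -
  have "(X * Y) $$ (i, j) = (\<Sum>l<n. X $$ (i, l) * Y $$ (l, j))"
    using assms by (auto simp: scalar_prod_def lessThan_atLeast0 intro!: sum.cong)
  then show ?thesis by (simp add: below_sum below_times)
qed

lemma pow_mat_add:
  fixes A :: "'a::semiring_1 mat"
  assumes "A \<in> carrier_mat n n"
  shows "A ^\<^sub>m (k + l) = A ^\<^sub>m k * A ^\<^sub>m l"
proof (induction l)
  case (Suc l)
  then show ?case using assms assoc_mult_mat[of "A ^\<^sub>m k" n n "A ^\<^sub>m l" n A n] by auto
qed (use assms in auto)

lemma below_pow_mat_add:
  assumes A: "A \<in> carrier_mat n n" and "i < n" "j < n" "l < n"
    and "w \<in> below ((A ^\<^sub>m k) $$ (i, l))" "w' \<in> below ((A ^\<^sub>m k') $$ (l, j))"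
  shows "w + w' \<in> below ((A ^\<^sub>m (k + k')) $$ (i, j))"
proof -
  have c: "A ^\<^sub>m k \<in> carrier_mat n n" for k using A by simp
  show ?thesis unfolding pow_mat_add[OF A] below_mult_mat[OF c c \<open>i < n\<close> \<open>j < n\<close>]
    using assms by blast
qed

text \<open>Lengths and weights of the nonempty walks from \<open>i\<close> to \<open>j\<close> whose intermediate vertices are
  smaller than \<open>m\<close>.\<close>

fun walks :: "zmax mat \<Rightarrow> nat \<Rightarrow> nat \<Rightarrow> nat \<Rightarrow> (nat \<times> int) set" where
  "walks A 0 i j = {1} \<times> {w. A $$ (i, j) = Fin w}"
| "walks A (Suc m) i j =
     walks A m i j \<union> (walks A m i m + nat_span (walks A m m m) + walks A m m j)"

lemma walks_length: "walks A m i j \<subseteq> {x. 0 < fst x}"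
proof (induction m arbitrary: i j)
  case (Suc m)
  have "walks A m i m + nat_span (walks A m m m) + walks A m m j \<subseteq> {x. 0 < fst x}"
    using Suc[of i m] by (fastforce elim!: set_plus_elim)
  then show ?case using Suc[of i j] by simp
qed auto

text \<open>Kleene's recursion uses only union, sum and star. Walks being nonempty,
  \<open>walks_length\<close> supplies the side condition of the star, and all periods get positive
  length.\<close>

lemma semilinear_walks: "semilinear {x. 0 < fst x} (walks A m i j)"
proof (induction m arbitrary: i j)
  case 0
  show ?case by (cases "A $$ (i, j)") (auto intro!: semilinear_finite)
next
  case (Suc m)
  then show ?case
    by (simp add: semilinear.union semilinear_plus semilinear_nat_span walks_length)
qed

lemma walks_sound:
  assumes A: "A \<in> carrier_mat n n"
  shows "m \<le> n \<Longrightarrow> i < n \<Longrightarrow> j < n \<Longrightarrow> (k, w) \<in> walks A m i j \<Longrightarrow> w \<in> below ((A ^\<^sub>m k) $$ (i, j))"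
proof (induction m arbitrary: i j k w)
  case 0
  then show ?case using A by auto
next
  case (Suc m)
  \<comment> \<open>\<open>nat_span\<close> forgets the order of the loops at \<open>m\<close>, but
    only total length and weight are recorded, so they may be concatenated one by one in any
    order.\<close>
  have loop: "snd x \<in> below ((A ^\<^sub>m fst x) $$ (m, m))" if "x \<in> nat_span (walks A m m m)" for x
    using that
  proof (induction rule: nat_span_induct)
    case zero
    show ?case using A Suc.prems by simp
  next
    case (add p y)
    then have "snd p \<in> below ((A ^\<^sub>m fst p) $$ (m, m))"
      using Suc.IH[of m m "fst p" "snd p"] Suc.prems by simp
    from below_pow_mat_add[OF A _ _ _ this add.IH] show ?case using Suc.prems by simp
  qed
  from Suc.prems(4) consider "(k, w) \<in> walks A m i j"
    | "(k, w) \<in> walks A m i m + nat_span (walks A m m m) + walks A m m j" by auto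
  then show ?case
  proof cases
    case 1
    then show ?thesis using Suc by auto
  next
    case 2
    then obtain x y z where xyz: "(k, w) = x + y + z" "x \<in> walks A m i m"
      "y \<in> nat_span (walks A m m m)" "z \<in> walks A m m j"
      by (auto elim!: set_plus_elim)
    have "snd x \<in> below ((A ^\<^sub>m fst x) $$ (i, m))" "snd z \<in> below ((A ^\<^sub>m fst z) $$ (m, j))"
      using Suc.IH[of i m "fst x" "snd x"] Suc.IH[of m j "fst z" "snd z"] Suc.prems xyz by auto
    with loop[OF xyz(3)] have "snd x + snd y + snd z \<in> below ((A ^\<^sub>m (fst x + fst y + fst z)) $$ (i, j))"
      using Suc.prems by (intro below_pow_mat_add[OF A, where l = m]) auto
    moreover have "k = fst x + fst y + fst z" "w = snd x + snd y + snd z"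
      using arg_cong[OF xyz(1), of fst] arg_cong[OF xyz(1), of snd] by auto
    ultimately show ?thesis by simp
  qed
qed

text \<open>Concatenation at an admissible vertex stays within the recursion. If \<open>l\<close> is
  the newest vertex, the two walks are split there; otherwise each part that meets at
  \<open>l\<close> is joined by the induction hypothesis.\<close>

lemma walks_compose:
  "l < m \<Longrightarrow> x \<in> walks A m i l \<Longrightarrow> y \<in> walks A m l j \<Longrightarrow> x + y \<in> walks A m i j"
proof (induction m arbitrary: i j l x y)
  case (Suc m)
  let ?S = "nat_span (walks A m m m)"
  have into: "a + s + b \<in> walks A (Suc m) i j" if "a \<in> walks A m i m" "s \<in> ?S" "b \<in> walks A m m j" for a b s i j
    using that by (auto intro!: set_plus_intro)
  show ?case
  proof (cases "l = m")
    case True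
    \<comment> \<open>The return to \<open>m\<close> at the end of \<open>x\<close> is itself a loop
      at \<open>m\<close>, so it joins the star; \<open>R\<close> does the same for the start of
      \<open>y\<close>.\<close>
    have L: "\<exists>a\<in>walks A m i m. \<exists>s\<in>?S. x = a + s"
    proof (cases "x \<in> walks A m i m")
      case True
      then show ?thesis using zero_in_nat_span by (intro bexI[of _ x] bexI[of _ 0]) auto
    next
      case False
      then obtain a s b where "x = a + s + b" "a \<in> walks A m i m" "s \<in> ?S" "b \<in> walks A m m m"
        using Suc.prems \<open>l = m\<close> by (auto elim!: set_plus_elim)
      then show ?thesis
        by (intro bexI[of _ a] bexI[of _ "s + b"]) (auto simp: add.assoc intro: nat_span_add nat_span_incl)
    qed
    have R: "\<exists>b\<in>walks A m m j. \<exists>s\<in>?S. y = s + b"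
    proof (cases "y \<in> walks A m m j")
      case True
      then show ?thesis using zero_in_nat_span by (intro bexI[of _ y] bexI[of _ 0]) auto
    next
      case False
      then obtain a s b where "y = a + s + b" "a \<in> walks A m m m" "s \<in> ?S" "b \<in> walks A m m j"
        using Suc.prems \<open>l = m\<close> by (auto elim!: set_plus_elim)
      then show ?thesis
        by (intro bexI[of _ b] bexI[of _ "a + s"]) (auto simp: add.assoc intro: nat_span_add nat_span_incl)
    qed
    from L R obtain a s s' b where "a \<in> walks A m i m" "s \<in> ?S" "x = a + s"
      "b \<in> walks A m m j" "s' \<in> ?S" "y = s' + b" by blast
    then show ?thesis using into[of a i "s + s'" b j] by (simp add: nat_span_add add.assoc)
  next
    case False
    then have l: "l < m" using Suc.prems by simp
    note comp = Suc.IH[OF l]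
    from Suc.prems(2) consider "x \<in> walks A m i l"
      | a s b where "x = a + s + b" "a \<in> walks A m i m" "s \<in> ?S" "b \<in> walks A m m l"
      by (auto elim!: set_plus_elim)
    then show ?thesis
    proof cases
      case x: 1
      from Suc.prems(3) consider "y \<in> walks A m l j"
        | a s b where "y = a + s + b" "a \<in> walks A m l m" "s \<in> ?S" "b \<in> walks A m m j"
        by (auto elim!: set_plus_elim)
      then show ?thesis
      proof cases
        case 1
        then show ?thesis using comp[OF x] by simp
      next
        case (2 a s b)
        then show ?thesis using into[OF comp[OF x 2(2)] 2(3,4)] by (simp add: add.assoc)
      qed
    next
      case x: (2 a s b)
      from Suc.prems(3) consider "y \<in> walks A m l j"
        | a s b where "y = a + s + b" "a \<in> walks A m l m" "s \<in> ?S" "b \<in> walks A m m j"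
        by (auto elim!: set_plus_elim)
      then show ?thesis
      proof cases
        case 1
        then show ?thesis using into[OF x(2,3) comp[OF x(4) 1]] x(1) by (simp add: add.assoc)
      next
        case (2 a' s' b')
        \<comment> \<open>When both walks visit \<open>m\<close>, the last piece of \<open>x\<close>
          and the first piece of \<open>y\<close> join at \<open>l\<close> into one more loop at
          \<open>m\<close>.\<close>
        have "s + (b + a') + s' \<in> ?S"
          by (intro nat_span_add nat_span_incl[OF comp[OF x(4) 2(2)]] x(3) 2(3))
        from into[OF x(2) this 2(4)] show ?thesis using x(1) 2(1) by (simp add: add.assoc)
      qed
    qed
  qed
qed simp

text \<open>A walk is built by appending edges: with \<open>m = n\<close> every vertex is
  admissible, so \<open>walks_compose\<close> applies at each of them. The weight \<open>w'\<close>
  may exceed \<open>w\<close> because \<open>below\<close> is closed downwards.\<close>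

lemma walks_complete:
  assumes A: "A \<in> carrier_mat n n"
  shows "i < n \<Longrightarrow> j < n \<Longrightarrow> w \<in> below ((A ^\<^sub>m Suc k) $$ (i, j)) \<Longrightarrow> \<exists>w'\<ge>w. (Suc k, w') \<in> walks A n i j"
proof (induction k arbitrary: j w)
  case edge: 0
  have mono: "walks A 0 i j \<subseteq> walks A m i j" for i j m by (induction m) auto
  have "\<exists>w'\<ge>w. (Suc 0, w') \<in> walks A 0 i j"
    using edge A by (cases "A $$ (i, j)") auto
  then show ?case using mono by blast
next
  case (Suc k)
  have mono: "walks A 0 i j \<subseteq> walks A m i j" for i j m by (induction m) auto
  have c: "A ^\<^sub>m Suc k \<in> carrier_mat n n" using A by (intro pow_carrier_mat)
  have "w \<in> below ((A ^\<^sub>m Suc k * A) $$ (i, j))" using Suc.prems(3) by simp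
  then obtain l a b where l: "l < n" "w = a + b" "a \<in> below ((A ^\<^sub>m Suc k) $$ (i, l))"
    "b \<in> below (A $$ (l, j))"
    unfolding below_mult_mat[OF c A Suc.prems(1,2)] by (auto elim!: set_plus_elim)
  obtain a' where a': "a' \<ge> a" "(Suc k, a') \<in> walks A n i l" using Suc.IH Suc.prems l by blast
  obtain b' where b': "b' \<ge> b" "A $$ (l, j) = Fin b'"
    using l(4) by (cases "A $$ (l, j)") auto
  then have "(1, b') \<in> walks A n l j" using mono[of l j n] by auto
  from walks_compose[OF l(1) a'(2) this] have "(Suc (Suc k), a' + b') \<in> walks A n i j"
    by simp
  then show ?case using a'(1) b'(1) l(2) by (intro exI[of _ "a' + b'"]) auto
qed

lemma ultimately_affine_pow_mat:
  assumes A: "A \<in> carrier_mat n n" and ij: "i < n" "j < n"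
  shows "ultimately_affine (\<lambda>k. below ((A ^\<^sub>m k) $$ (i, j)))"
proof (rule ultimately_affine_cong)
  show "ultimately_affine (level (walks A n i j))"
    by (intro ultimately_affine_semilinear semilinear_walks)
  \<comment> \<open>\<open>walks\<close> contains nonempty walks only, so the power with exponent 0
    is left out; a single exponent does not affect ultimate behaviour.\<close>
  fix k :: nat assume "k \<ge> 1"
  then obtain k' where k: "k = Suc k'" by (cases k) auto
  show "below ((A ^\<^sub>m k) $$ (i, j)) = level (walks A n i j) k"
  proof (intro equalityI subsetI)
    fix w assume "w \<in> level (walks A n i j) k"
    then obtain w' where "w \<le> w'" "(k, w') \<in> walks A n i j" by (auto simp: level_def)
    then have "w' \<in> below ((A ^\<^sub>m k) $$ (i, j))" using walks_sound[OF A order_refl ij] by blast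
    with \<open>w \<le> w'\<close> show "w \<in> below ((A ^\<^sub>m k) $$ (i, j))"
      by (cases "(A ^\<^sub>m k) $$ (i, j)") auto
  qed (use walks_complete[OF A ij] k in \<open>auto simp: level_def\<close>)
qed

lemma ultimately_affine_mult_pow_mat:
  assumes A: "A \<in> carrier_mat n n" and C: "C \<in> carrier_mat q n" and ij: "i < q" "j < n"
  shows "ultimately_affine (\<lambda>k. below ((C * A ^\<^sub>m k) $$ (i, j)))"
proof -
  have "ultimately_affine (\<lambda>k. below (C $$ (i, l)) + below ((A ^\<^sub>m k) $$ (l, j)))" if "l < n" for l
  proof (cases "C $$ (i, l)")
    case NegInf
    then show ?thesis by (simp add: ultimately_affine_empty)
  next
    case (Fin c)
    then show ?thesis
      using ultimately_affine_translate[OF ultimately_affine_pow_mat[OF A that ij(2)], of c]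
      by (simp only: below_times[symmetric] below_Fin_times)
  qed
  then have "ultimately_affine (\<lambda>k. \<Union>l<n. below (C $$ (i, l)) + below ((A ^\<^sub>m k) $$ (l, j)))"
    by (intro ultimately_affine_UN) auto
  then show ?thesis using A by (simp add: below_mult_mat[OF C _ ij])
qed

section \<open>Conditions preserving semilinearity\<close>

text \<open>Formulated as restriction of an arbitrary semilinear \<open>S\<close>, so that
  conjunction is restriction twice. The ambient \<open>S\<close> is essential for functions
  \<open>nat \<Rightarrow> int\<close>, whose whole type is not semilinear.\<close>

definition semilinear_condition :: "('a::comm_monoid_add \<Rightarrow> bool) \<Rightarrow> bool" where
  "semilinear_condition \<Phi> \<longleftrightarrow> (\<forall>S. semilinear UNIV S \<longrightarrow> semilinear UNIV {x \<in> S. \<Phi> x})"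

lemma semilinear_condition_conj:
  assumes "semilinear_condition \<Phi>" "semilinear_condition \<Psi>"
  shows "semilinear_condition (\<lambda>x. \<Phi> x \<and> \<Psi> x)"
  unfolding semilinear_condition_def
proof (intro allI impI)
  fix S :: "'a set" assume "semilinear UNIV S"
  then have "semilinear UNIV {x \<in> {x \<in> S. \<Phi> x}. \<Psi> x}"
    using assms unfolding semilinear_condition_def by blast
  moreover have "{x \<in> {x \<in> S. \<Phi> x}. \<Psi> x} = {x \<in> S. \<Phi> x \<and> \<Psi> x}" by auto
  ultimately show "semilinear UNIV {x \<in> S. \<Phi> x \<and> \<Psi> x}" by simp
qed

lemma semilinear_condition_ball:
  assumes "finite I" "\<And>i. i \<in> I \<Longrightarrow> semilinear_condition (\<Phi> i)"
  shows "semilinear_condition (\<lambda>x. \<forall>i\<in>I. \<Phi> i x)"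
  using assms
  by (induction I rule: finite_induct)
    (simp add: semilinear_condition_def, simp add: semilinear_condition_conj)

lemma semilinear_condition_bex:
  assumes "finite I" "\<And>i. i \<in> I \<Longrightarrow> semilinear_condition (\<Phi> i)"
  shows "semilinear_condition (\<lambda>x. \<exists>i\<in>I. \<Phi> i x)"
proof -
  have "{x \<in> S. \<exists>i\<in>I. \<Phi> i x} = (\<Union>i\<in>I. {x \<in> S. \<Phi> i x})" for S by auto
  then show ?thesis using assms by (simp add: semilinear_condition_def semilinear_UN)
qed

section \<open>Linear inequalities, existential quantifiers and the breakpoint\<close>

lemma semilinear_int_atLeast: "semilinear UNIV {c::int..}"
proof -
  have "int n \<in> nat_span {1}" for n
    by (induction n) (auto intro: zero_in_nat_span nat_span_add nat_span_incl)
  moreover have "0 \<le> x" if "x \<in> nat_span {1}" for x :: int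
    using that by (induction rule: nat_span_induct) auto
  ultimately have "linear_set c {1} = {c..}"
    unfolding linear_set_def
    by (auto simp: image_iff) (metis add_diff_cancel_left' diff_ge_0_iff_ge le_add_diff_inverse nonneg_int_cases)
  then show ?thesis using semilinear.linear[of "{1}" UNIV c] by simp
qed

lemma semilinear_condition_ge:
  fixes h :: "'a::comm_monoid_add \<Rightarrow> int"
  assumes "\<And>x y. h (x + y) = h x + h y"
  shows "semilinear_condition (\<lambda>x. 0 \<le> c + h x)"
proof -
  have "{x \<in> S. 0 \<le> c + h x} = {x \<in> S. h x \<in> {- c..}}" for S by auto
  then show ?thesis
    using semilinear_Int_vimage[OF _ semilinear_int_atLeast assms]
    by (auto simp: semilinear_condition_def)
qed

lemma semilinear_Times:
  fixes X :: "'a::comm_monoid_add set" and Y :: "'b::comm_monoid_add set"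
  assumes "semilinear T X" "semilinear T' Y"
  shows "semilinear UNIV (X \<times> Y)"
proof -
  have "X \<times> Y = (\<lambda>x. (x, 0::'b)) ` X + Pair (0::'a) ` Y"
    by (force simp: set_plus_def image_iff)
  moreover have "semilinear UNIV ((\<lambda>x. (x, 0::'b)) ` X)" "semilinear UNIV (Pair (0::'a) ` Y)"
    using assms by (auto intro!: semilinear_image simp: zero_prod_def)
  ultimately show ?thesis by (simp add: semilinear_plus)
qed

text \<open>An existential quantifier is a projection, hence an additive image, of a restriction of
  \<open>S \<times> {0..}\<close>.\<close>

lemma semilinear_condition_ex:
  fixes \<Phi> :: "'a::comm_monoid_add \<times> int \<Rightarrow> bool"
  assumes "semilinear_condition \<Phi>"
  shows "semilinear_condition (\<lambda>x. \<exists>t\<ge>0. \<Phi> (x, t))"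
  unfolding semilinear_condition_def
proof (intro allI impI)
  fix S :: "'a set" assume "semilinear UNIV S"
  then have "semilinear UNIV (S \<times> {0::int..})"
    by (rule semilinear_Times) (rule semilinear_int_atLeast)
  then have "semilinear UNIV {x \<in> S \<times> {0..}. \<Phi> x}"
    using assms unfolding semilinear_condition_def by blast
  then have "semilinear UNIV (fst ` {x \<in> S \<times> {0..}. \<Phi> x})"
    by (rule semilinear_image) auto
  moreover have "fst ` {x \<in> S \<times> {0..}. \<Phi> x} = {x \<in> S. \<exists>t\<ge>0. \<Phi> (x, t)}"
    by (force simp: image_iff)
  ultimately show "semilinear UNIV {x \<in> S. \<exists>t\<ge>0. \<Phi> (x, t)}" by simp
qed

text \<open>The affine functions of nonpositive slope are nonnegative on initial segments, the others on
  final segments; these cover \<open>\<nat>\<close> iff some initial segment ends where some final one begins.\<close>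

lemma affine_cover_iff:
  fixes \<alpha> \<beta> :: "'i \<Rightarrow> int"
  assumes "finite I"
  shows "(\<forall>p::nat. \<exists>i\<in>I. 0 \<le> \<alpha> i + \<beta> i * int p) \<longleftrightarrow>
    (\<exists>i\<in>I. \<exists>j\<in>{j \<in> I. 0 \<le> \<beta> j}. \<exists>t\<ge>0.
       0 \<le> \<alpha> i \<and> 0 \<le> \<alpha> i + \<beta> i * t \<and> 0 \<le> \<alpha> j + \<beta> j * (t + 1))" (is "?L \<longleftrightarrow> ?R")
proof
  assume ?R
  then obtain i j t where ij: "i \<in> I" "j \<in> I" and t: "0 \<le> t" and i: "0 \<le> \<alpha> i" "0 \<le> \<alpha> i + \<beta> i * t"
    and j: "0 \<le> \<beta> j" "0 \<le> \<alpha> j + \<beta> j * (t + 1)"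
    by blast
  show ?L
  proof
    fix p :: nat
    show "\<exists>i\<in>I. 0 \<le> \<alpha> i + \<beta> i * int p"
    proof (cases "int p \<le> t")
      case True
      \<comment> \<open>An affine function that is nonnegative at both ends 0 and \<open>t\<close>
        is nonnegative in between, whatever the sign of its slope.\<close>
      have "0 \<le> \<alpha> i + \<beta> i * int p"
      proof (cases "0 \<le> \<beta> i")
        case False
        then have "\<beta> i * t \<le> \<beta> i * int p" using True by (intro mult_left_mono_neg) auto
        then show ?thesis using i by simp
      qed (use i in simp)
      then show ?thesis using ij by blast
    next
      case False
      then have "\<beta> j * (t + 1) \<le> \<beta> j * int p" using j by (intro mult_left_mono) auto
      then show ?thesis using ij j by (intro bexI[of _ j]) auto
    qed
  qed
next
  assume L: ?L
  \<comment> \<open>By pigeonhole one function is nonnegative infinitely often, so its slope cannot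
    be negative and it covers a final segment.\<close>
  have "\<exists>i\<in>I. infinite {p \<in> UNIV. 0 \<le> \<alpha> i + \<beta> i * int p}"
    using L by (intro pigeonhole_infinite_rel[OF infinite_UNIV_nat assms]) auto
  then obtain i where i: "i \<in> I" "infinite {p::nat. 0 \<le> \<alpha> i + \<beta> i * int p}" by auto
  have "0 \<le> \<beta> i"
  proof (rule ccontr)
    assume "\<not> 0 \<le> \<beta> i"
    then have "\<beta> i * int p \<le> - int p" for p
      using mult_right_mono[of "\<beta> i" "- 1" "int p"] by simp
    then have "int p \<le> \<alpha> i" if "0 \<le> \<alpha> i + \<beta> i * int p" for p
      using that by (smt (verit))
    then have "{p::nat. 0 \<le> \<alpha> i + \<beta> i * int p} \<subseteq> {..nat (\<alpha> i)}" by fastforce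
    then show False using i(2) finite_subset by blast
  qed
  moreover obtain p :: nat where "0 \<le> \<alpha> i + \<beta> i * int p"
    using i(2) by (metis (mono_tags, lifting) empty_Collect_eq finite.emptyI)
  ultimately have ex: "\<exists>p::nat. \<exists>j\<in>I. 0 \<le> \<beta> j \<and> 0 \<le> \<alpha> j + \<beta> j * int p" using i(1) by blast
  \<comment> \<open>\<open>m\<close> is where the first final segment begins, so the breakpoint is
    \<open>m - 1\<close>. If \<open>m = 0\<close>, the function \<open>j\<close> covers everything
    and serves as \<open>i\<close> too, with \<open>t = 0\<close>.\<close>
  define m :: nat where "m = (LEAST p. \<exists>j\<in>I. 0 \<le> \<beta> j \<and> 0 \<le> \<alpha> j + \<beta> j * int p)"
  obtain j where j: "j \<in> I" "0 \<le> \<beta> j" "0 \<le> \<alpha> j + \<beta> j * int m"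
    using LeastI_ex[OF ex] unfolding m_def by blast
  show ?R
  proof (cases m)
    case 0
    then have "0 \<le> \<alpha> j \<and> 0 \<le> \<alpha> j + \<beta> j * 0 \<and> 0 \<le> \<alpha> j + \<beta> j * (0 + 1)" using j by simp
    then show ?thesis using j(1,2) by blast
  next
    case (Suc t)
    obtain i where i: "i \<in> I" "0 \<le> \<alpha> i + \<beta> i * int t" using L by blast
    \<comment> \<open>By minimality of \<open>m\<close>, whatever covers \<open>t = m - 1\<close>
      has negative slope, hence is nonnegative at 0 as well.\<close>
    have "\<beta> i < 0"
      using not_less_Least[of t "\<lambda>p. \<exists>j\<in>I. 0 \<le> \<beta> j \<and> 0 \<le> \<alpha> j + \<beta> j * int p"] i Suc
      unfolding m_def[symmetric] by force
    then have "\<beta> i * int t \<le> 0" by (simp add: mult_nonpos_nonneg)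
    then have "0 \<le> \<alpha> i \<and> 0 \<le> \<alpha> i + \<beta> i * int t \<and> 0 \<le> \<alpha> j + \<beta> j * (int t + 1)"
      using i j Suc by (auto simp: algebra_simps)
    moreover have "(0::int) \<le> int t" by simp
    ultimately show ?thesis using i(1) j(1,2) by blast
  qed
qed

text \<open>The slopes \<open>b i\<close> are constants, so \<open>b i * t\<close> is additive in
  \<open>t\<close> and the breakpoint conditions are linear inequalities in the pair
  \<open>(x, t)\<close>.\<close>

lemma semilinear_condition_affine_cover:
  fixes g :: "'i \<Rightarrow> 'a::comm_monoid_add \<Rightarrow> int"
  assumes "finite I" and g: "\<And>i x y. g i (x + y) = g i x + g i y"
  shows "semilinear_condition (\<lambda>x. \<forall>p::nat. \<exists>i\<in>I. 0 \<le> (a i + g i x) + b i * int p)"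
proof -
  have "semilinear_condition (\<lambda>x. \<exists>t\<ge>0. 0 \<le> a i + g i (fst (x, t)) \<and>
      0 \<le> a i + (g i (fst (x, t)) + b i * snd (x, t)) \<and>
      0 \<le> (a j + b j) + (g j (fst (x, t)) + b j * snd (x, t)))" for i j
    by (rule semilinear_condition_ex[where \<Phi> = "\<lambda>z. 0 \<le> a i + g i (fst z) \<and>
      0 \<le> a i + (g i (fst z) + b i * snd z) \<and> 0 \<le> (a j + b j) + (g j (fst z) + b j * snd z)"],
      intro semilinear_condition_conj semilinear_condition_ge) (auto simp: g algebra_simps)
  then have "semilinear_condition (\<lambda>x. \<exists>t\<ge>0. 0 \<le> a i + g i x \<and>
      0 \<le> a i + g i x + b i * t \<and> 0 \<le> a j + g j x + b j * (t + 1))" for i j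
    by (simp add: algebra_simps)
  then show ?thesis
    unfolding affine_cover_iff[OF assms(1)] using assms(1)
    by (intro semilinear_condition_bex) auto
qed

text \<open>Multiplicities are nonnegative, so each coordinate contributes two periods, its unit
  vector and the negative of it.\<close>

lemma semilinear_int_vectors: "semilinear UNIV {f :: nat \<Rightarrow> int. \<forall>i\<ge>m. f i = 0}"
proof (induction m)
  case 0
  have "{f :: nat \<Rightarrow> int. \<forall>i\<ge>0. f i = 0} = {\<lambda>_. 0}" by auto
  then show ?case by (simp add: semilinear_singleton)
next
  case (Suc m)
  define e where "e c = (\<lambda>i. if i = m then c else 0)" for c :: int
  have e: "e (c + d) = e c + e d" for c d by (auto simp: e_def fun_eq_iff)
  have z: "e 0 = 0" by (auto simp: e_def)
  let ?E = "nat_span {e 1, e (- 1)}"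
  have "e (int k) \<in> ?E \<and> e (- int k) \<in> ?E" for k
  proof (induction k)
    case 0
    have "e 0 \<in> ?E" unfolding z by (rule zero_in_nat_span)
    then show ?case by simp
  next
    case (Suc k)
    have "e (int (Suc k)) = e 1 + e (int k)" "e (- int (Suc k)) = e (- 1) + e (- int k)"
      by (simp_all flip: e)
    moreover have "e 1 + e (int k) \<in> ?E" "e (- 1) + e (- int k) \<in> ?E"
      using Suc by (blast intro: nat_span_add nat_span_incl)+
    ultimately show ?case by (simp only:)
  qed
  then have E: "e c \<in> ?E" for c by (cases c rule: int_cases2) auto
  have E': "f i = 0" if "f \<in> ?E" "i > m" for f i
    using that by (induction rule: nat_span_induct) (auto simp: e_def)
  have "{f :: nat \<Rightarrow> int. \<forall>i\<ge>Suc m. f i = 0} = {f. \<forall>i\<ge>m. f i = 0} + ?E"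
  proof (intro equalityI subsetI)
    fix f :: "nat \<Rightarrow> int" assume f: "f \<in> {f. \<forall>i\<ge>Suc m. f i = 0}"
    have "f(m := 0) + e (f m) \<in> {f. \<forall>i\<ge>m. f i = 0} + ?E"
      using f by (intro set_plus_intro E) auto
    moreover have "f(m := 0) + e (f m) = f" by (auto simp: e_def fun_eq_iff)
    ultimately show "f \<in> {f. \<forall>i\<ge>m. f i = 0} + ?E" by simp
  next
    fix f :: "nat \<Rightarrow> int" assume "f \<in> {f. \<forall>i\<ge>m. f i = 0} + ?E"
    then show "f \<in> {f. \<forall>i\<ge>Suc m. f i = 0}" using E' by (auto elim!: set_plus_elim)
  qed
  then show ?case using Suc by (auto intro!: semilinear_plus semilinear_nat_span_finite)
qed

section \<open>Equality of max-plus linear forms along an arithmetic progression\<close>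

text \<open>A max-plus vector with support \<open>S\<close>; the values of \<open>f\<close> outside
  \<open>S\<close> are ignored.\<close>

definition masked :: "nat set \<Rightarrow> (nat \<Rightarrow> int) \<Rightarrow> nat \<Rightarrow> zmax" where
  "masked S f i = (if i \<in> S then Fin (f i) else NegInf)"

text \<open>A factor \<open>Fin (f i)\<close> only translates, so each affine term gains the summand
  \<open>f i\<close>, and the index \<open>i\<close> is stored with it. The point is that
  \<open>G\<close> does not depend on \<open>f\<close>. The offset \<open>c\<close> selects one half
  of the pair.\<close>

lemma below_linear_form:
  fixes s :: "nat \<Rightarrow> nat \<Rightarrow> zmax"
  assumes "\<And>j. j < n \<Longrightarrow> affine_max (\<lambda>p. below (s j p))"
  shows "\<exists>G. finite G \<and> (\<forall>f p. below (\<Sum>j<n. s j p * masked S f (c + j)) =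
    {w. \<exists>(a, l, i)\<in>G. w \<le> a + f i + l * int p})"
proof -
  have "\<forall>j\<in>{..<n}. \<exists>F. finite F \<and> (\<forall>p. below (s j p) = {w. \<exists>(a, l)\<in>F. w \<le> a + l * int p})"
    using assms by (auto simp: affine_max_def)
  from bchoice[OF this] obtain F where "\<forall>j\<in>{..<n}. finite (F j) \<and>
    (\<forall>p. below (s j p) = {w. \<exists>(a, l)\<in>F j. w \<le> a + l * int p})" ..
  then have F: "\<And>j. j < n \<Longrightarrow> finite (F j)"
    "\<And>j p. j < n \<Longrightarrow> below (s j p) = {w. \<exists>(a, l)\<in>F j. w \<le> a + l * int p}"
    by auto
  define G where "G = (\<Union>j\<in>{j. j < n \<and> c + j \<in> S}. (\<lambda>(a, l). (a, l, c + j)) ` F j)"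
  have "finite G" using F by (auto simp: G_def)
  moreover have "below (\<Sum>j<n. s j p * masked S f (c + j)) =
      {w. \<exists>(a, l, i)\<in>G. w \<le> a + f i + l * int p}" for f p
  proof -
    have summand: "below (s j p * masked S f (c + j)) =
        (if c + j \<in> S then {w. \<exists>(a, l)\<in>F j. w \<le> a + f (c + j) + l * int p} else {})"
      if "j < n" for j
    proof (cases "c + j \<in> S")
      case True
      have "below (s j p * masked S f (c + j)) = (\<lambda>w. f (c + j) + w) ` below (s j p)"
        using True below_Fin_times[of "f (c + j)" "s j p"] by (simp add: masked_def mult.commute)
      also have "\<dots> = {w. w - f (c + j) \<in> below (s j p)}"
        by (force intro: image_eqI[where x = "_ - _"])
      finally show ?thesis using True by (auto simp: F(2)[OF that] algebra_simps)
    qed (simp add: masked_def below_times)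
    show ?thesis
      by (auto simp: below_sum summand G_def split_beta split: if_splits)
  qed
  ultimately show ?thesis by (intro exI[of _ G] conjI allI)
qed

text \<open>Equality of two maxima is two inequalities. One maximum is at most the other when, for
  each term \<open>y\<close> on the left and each \<open>p\<close>, some difference
  \<open>z - y\<close> is nonnegative; for fixed \<open>y\<close> this is a covering condition whose
  slopes are constants.\<close>

lemma semilinear_condition_linear_forms_eq:
  fixes s :: "nat \<Rightarrow> nat \<Rightarrow> zmax"
  assumes "\<And>j. j < n \<Longrightarrow> affine_max (\<lambda>p. below (s j p))"
  shows "semilinear_condition (\<lambda>f. \<forall>p::nat.
    (\<Sum>j<n. s j p * masked S f (c + j)) = (\<Sum>j<n. s j p * masked S f (d + j)))"
proof -
  obtain G where G: "finite G" "\<And>f p. below (\<Sum>j<n. s j p * masked S f (c + j)) =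
      {w. \<exists>(a, l, i)\<in>G. w \<le> a + f i + l * int p}"
    using below_linear_form[of n s S c, OF assms] by blast
  obtain H where H: "finite H" "\<And>f p. below (\<Sum>j<n. s j p * masked S f (d + j)) =
      {w. \<exists>(a, l, i)\<in>H. w \<le> a + f i + l * int p}"
    using below_linear_form[of n s S d, OF assms] by blast
  define v :: "int \<times> int \<times> nat \<Rightarrow> (nat \<Rightarrow> int) \<Rightarrow> nat \<Rightarrow> int"
    where "v y f p = fst y + f (snd (snd y)) + fst (snd y) * int p" for y f p
  have v: "{w. \<exists>(a, l, i)\<in>G. w \<le> a + f i + l * int p} = (\<Union>y\<in>G. {..v y f p})" for G f p
    by (auto simp: set_eq_iff v_def split_beta)
  have sub: "(\<Union>y\<in>G. {..v y f p}) \<subseteq> (\<Union>z\<in>H. {..v z f p}) \<longleftrightarrow> (\<forall>y\<in>G. \<exists>z\<in>H. v y f p \<le> v z f p)"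
    for G H f p
  proof
    assume sub: "(\<Union>y\<in>G. {..v y f p}) \<subseteq> (\<Union>z\<in>H. {..v z f p})"
    show "\<forall>y\<in>G. \<exists>z\<in>H. v y f p \<le> v z f p"
    proof
      fix y assume "y \<in> G"
      then have "v y f p \<in> (\<Union>z\<in>H. {..v z f p})" by (intro subsetD[OF sub]) auto
      then show "\<exists>z\<in>H. v y f p \<le> v z f p" by simp
    qed
  next
    assume le: "\<forall>y\<in>G. \<exists>z\<in>H. v y f p \<le> v z f p"
    show "(\<Union>y\<in>G. {..v y f p}) \<subseteq> (\<Union>z\<in>H. {..v z f p})"
    proof
      fix w assume "w \<in> (\<Union>y\<in>G. {..v y f p})"
      then obtain y where "y \<in> G" "w \<le> v y f p" by auto
      then obtain z where "z \<in> H" "w \<le> v z f p" using le order_trans by blast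
      then show "w \<in> (\<Union>z\<in>H. {..v z f p})" by auto
    qed
  qed
  have le: "v y f p \<le> v z f p \<longleftrightarrow>
      0 \<le> ((fst z - fst y) + (f (snd (snd z)) - f (snd (snd y)))) + (fst (snd z) - fst (snd y)) * int p"
    for y z f p
    by (simp add: v_def algebra_simps)
  have cover: "semilinear_condition (\<lambda>f. \<forall>y\<in>G. \<forall>p. \<exists>z\<in>H. v y f p \<le> v z f p)"
    if "finite G" "finite H" for G H
    unfolding le using that
    by (intro semilinear_condition_ball semilinear_condition_affine_cover) auto
  have "(\<forall>p. (\<Sum>j<n. s j p * masked S f (c + j)) = (\<Sum>j<n. s j p * masked S f (d + j))) \<longleftrightarrow>
      (\<forall>y\<in>G. \<forall>p. \<exists>z\<in>H. v y f p \<le> v z f p) \<and> (\<forall>y\<in>H. \<forall>p. \<exists>z\<in>G. v y f p \<le> v z f p)" for f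
    unfolding below_inject[symmetric] G(2) H(2) v set_eq_subset sub by blast
  then show ?thesis using cover G(1) H(1) by (simp add: semilinear_condition_conj)
qed

section \<open>Rational sets of max-plus vectors\<close>

lemma entrywise_monoid_simps [simp]:
  "carrier (entrywise_monoid m) = carrier_vec m"
  "\<one>\<^bsub>entrywise_monoid m\<^esub> = vec m (\<lambda>i. 1)"
  "u \<otimes>\<^bsub>entrywise_monoid m\<^esub> v = vec m (\<lambda>i. u $ i * v $ i)"
  by (simp_all add: entrywise_monoid_def)

text \<open>Adding a vector without infinite entries preserves the support, so periods are always
  taken with mask \<open>UNIV\<close>.\<close>

lemma entrywise_mult_masked:
  "vec m (masked S f) \<otimes>\<^bsub>entrywise_monoid m\<^esub> vec m (masked UNIV g) = vec m (masked S (f + g))"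
  by (rule eq_vecI) (auto simp: masked_def)

lemma set_star_masked:
  "set_star (entrywise_monoid m) ((\<lambda>f. vec m (masked UNIV f)) ` P) =
     (\<lambda>f. vec m (masked UNIV f)) ` nat_span P" (is "set_star ?M (?e ` P) = _")
proof (intro equalityI subsetI)
  have one: "\<one>\<^bsub>?M\<^esub> = ?e 0" by (rule eq_vecI) (auto simp: masked_def one_zmax_def)
  have pow: "set_power ?M (?e ` P) k \<subseteq> ?e ` nat_span P" for k
  proof (induction k)
    case 0
    show ?case using zero_in_nat_span one by auto
  next
    case (Suc k)
    show ?case
    proof
      fix x assume "x \<in> set_power ?M (?e ` P) (Suc k)"
      then obtain y p where y: "y \<in> set_power ?M (?e ` P) k" and p: "p \<in> P"
        and x: "x = y \<otimes>\<^bsub>?M\<^esub> ?e p"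
        by (auto simp: set_mult_def)
      obtain f where "y = ?e f" "f \<in> nat_span P" using y Suc by blast
      then have "x = ?e (f + p)" "f + p \<in> nat_span P"
        using x p by (simp_all only: entrywise_mult_masked nat_span_add nat_span_incl)
      then show "x \<in> ?e ` nat_span P" by blast
    qed
  qed
  then show "x \<in> ?e ` nat_span P" if "x \<in> set_star ?M (?e ` P)" for x
    using that by (auto simp: set_star_def)
  have "\<exists>k. ?e f \<in> set_power ?M (?e ` P) k" if "f \<in> nat_span P" for f
    using that
  proof (induction rule: nat_span_induct)
    case zero
    have "?e 0 \<in> set_power ?M (?e ` P) 0" using one by simp
    then show ?case by blast
  next
    case (add p y)
    then obtain k where "?e y \<in> set_power ?M (?e ` P) k" by blast
    then have "?e y \<otimes>\<^bsub>?M\<^esub> ?e p \<in> set_power ?M (?e ` P) (Suc k)"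
      using add.hyps(1) by (auto simp: set_mult_def)
    then show ?case by (auto simp only: entrywise_mult_masked add.commute[of p y])
  qed
  then show "x \<in> set_star ?M (?e ` P)" if "x \<in> ?e ` nat_span P" for x
    using that by (auto simp: set_star_def)
qed

text \<open>A linear set is a singleton times a star. Only the singleton carries the mask
  \<open>S\<close>; its infinite entries absorb whatever the periods add there.\<close>

lemma rational_subset_masked:
  assumes "semilinear T Y"
  shows "rational_subset (entrywise_monoid m) ((\<lambda>f. vec m (masked S f)) ` Y)"
  using assms
proof induction
  case empty
  show ?case by (simp add: rational_subset.finite)
next
  case (linear P u)
  have "{vec m (masked S u)} <#>\<^bsub>entrywise_monoid m\<^esub> (\<lambda>f. vec m (masked UNIV f)) ` nat_span P =
      (\<lambda>f. vec m (masked S u) \<otimes>\<^bsub>entrywise_monoid m\<^esub> vec m (masked UNIV f)) ` nat_span P"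
    by (auto simp: set_mult_def)
  then have "(\<lambda>f. vec m (masked S f)) ` linear_set u P =
      {vec m (masked S u)} <#>\<^bsub>entrywise_monoid m\<^esub> (\<lambda>f. vec m (masked UNIV f)) ` nat_span P"
    by (simp only: entrywise_mult_masked linear_set_def image_image)
  moreover have "rational_subset (entrywise_monoid m)
      ({vec m (masked S u)} <#>\<^bsub>entrywise_monoid m\<^esub>
       set_star (entrywise_monoid m) ((\<lambda>f. vec m (masked UNIV f)) ` P))"
    using linear(1) by (intro rational_subset.intros) auto
  ultimately show ?case by (simp only: set_star_masked)
next
  case (union X Y)
  then show ?case by (simp add: image_Un rational_subset.union)
qed

lemma rational_subset_UN:
  "finite I \<Longrightarrow> (\<And>i. i \<in> I \<Longrightarrow> rational_subset M (X i)) \<Longrightarrow> rational_subset M (\<Union>i\<in>I. X i)"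
  by (induction I rule: finite_induct) (auto intro: rational_subset.intros)

lemma semimodule_span_subsemimodule:
  assumes X: "subsemimodule m X"
  shows "semimodule_span m X = X"
proof (intro equalityI subsetI)
  fix x assume "x \<in> semimodule_span m X"
  then obtain k c u where u: "\<forall>i<(k::nat). u i \<in> X"
    and x: "x = finsum_vec TYPE(zmax) m (\<lambda>i. c i \<cdot>\<^sub>v u i) {..<k}"
    by (auto simp: semimodule_span_def)
  have "finsum_vec TYPE(zmax) m (\<lambda>i. c i \<cdot>\<^sub>v u i) {..<k'} \<in> X" if "k' \<le> k" for k'
    using that
  proof (induction k')
    case 0
    then show ?case using X by (simp add: finsum_vec_empty subsemimodule_def)
  next
    case (Suc k')
    have in_X: "c i \<cdot>\<^sub>v u i \<in> X" if "i < k" for i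
      using X u that by (simp add: subsemimodule_def)
    moreover have "X \<subseteq> carrier_vec m" using X by (simp add: subsemimodule_def)
    ultimately have car: "c i \<cdot>\<^sub>v u i \<in> carrier_vec m" if "i < k" for i
      using that by blast
    have "finsum_vec TYPE(zmax) m (\<lambda>i. c i \<cdot>\<^sub>v u i) {..<Suc k'} =
        c k' \<cdot>\<^sub>v u k' + finsum_vec TYPE(zmax) m (\<lambda>i. c i \<cdot>\<^sub>v u i) {..<k'}"
      unfolding lessThan_Suc using car Suc.prems
      by (subst finsum_vec_insert) auto
    then show ?case using X in_X[of k'] Suc by (simp add: subsemimodule_def)
  qed
  then show "x \<in> X" using x by simp
next
  fix x assume x: "x \<in> X"
  have "x \<in> carrier_vec m" using X x by (auto simp: subsemimodule_def)
  then have "x = finsum_vec TYPE(zmax) m (\<lambda>i. 1 \<cdot>\<^sub>v x) {..<1::nat}"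
    unfolding lessThan_Suc One_nat_def by (subst finsum_vec_insert) (auto simp: finsum_vec_empty)
  then show "x \<in> semimodule_span m X"
    using x by (auto simp: semimodule_span_def intro!: exI[of _ "1::nat"] exI[of _ "\<lambda>_. 1"] exI[of _ "\<lambda>_. x"])
qed

lemma masked_surj:
  assumes "x \<in> carrier_vec m"
  shows "\<exists>S\<subseteq>{..<m}. \<exists>f. (\<forall>i\<ge>m. f i = 0) \<and> x = vec m (masked S f)"
proof -
  define S where "S = {i. i < m \<and> x $ i \<noteq> NegInf}"
  \<comment> \<open>The default 0, both at infinite entries and from \<open>m\<close> on, places
    \<open>f\<close> in the set of \<open>semilinear_int_vectors\<close>.\<close>
  define f where "f i = (if i < m then case x $ i of NegInf \<Rightarrow> 0 | Fin a \<Rightarrow> a else 0)" for i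
  have "x = vec m (masked S f)"
    using assms by (intro eq_vecI) (auto simp: masked_def S_def f_def split: zmax.split)
  then show ?thesis by (intro exI[of _ S] conjI exI[of _ f]) (auto simp: S_def f_def)
qed

lemma pair_vec_observable_congruence:
  assumes A: "A \<in> carrier_mat n n" and C: "C \<in> carrier_mat q n"
  shows "pair_vec ` observable_congruence n A C = {x \<in> carrier_vec (2 * n). \<forall>i<q. \<forall>k.
    (\<Sum>j<n. (C * A ^\<^sub>m k) $$ (i, j) * x $ j) = (\<Sum>j<n. (C * A ^\<^sub>m k) $$ (i, j) * x $ (n + j))}"
    (is "_ = ?R")
proof -
  have mult: "((C * A ^\<^sub>m k) *\<^sub>v \<xi> = (C * A ^\<^sub>m k) *\<^sub>v \<xi>') \<longleftrightarrow>
      (\<forall>i<q. (\<Sum>j<n. (C * A ^\<^sub>m k) $$ (i, j) * \<xi> $ j) = (\<Sum>j<n. (C * A ^\<^sub>m k) $$ (i, j) * \<xi>' $ j))"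
    if "\<xi> \<in> carrier_vec n" "\<xi>' \<in> carrier_vec n" for \<xi> \<xi>' k
  proof -
    have M: "C * A ^\<^sub>m k \<in> carrier_mat q n" using A C by simp
    have "((C * A ^\<^sub>m k) *\<^sub>v \<zeta>) $ i = (\<Sum>j<n. (C * A ^\<^sub>m k) $$ (i, j) * \<zeta> $ j)"
      if "\<zeta> \<in> carrier_vec n" "i < q" for \<zeta> i
      using that M by (auto simp: scalar_prod_def lessThan_atLeast0 simp del: index_mult_mat intro!: sum.cong)
    moreover have "dim_vec ((C * A ^\<^sub>m k) *\<^sub>v \<zeta>) = q" for \<zeta> using C by simp
    ultimately show ?thesis using that by (auto simp: vec_eq_iff)
  qed
  have app: "(\<Sum>j<n. t j * pair_vec (\<xi>, \<xi>') $ j) = (\<Sum>j<n. t j * \<xi> $ j)"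
    "(\<Sum>j<n. t j * pair_vec (\<xi>, \<xi>') $ (n + j)) = (\<Sum>j<n. t j * \<xi>' $ j)"
    if "\<xi> \<in> carrier_vec n" "\<xi>' \<in> carrier_vec n" for \<xi> \<xi>' and t :: "nat \<Rightarrow> zmax"
    using that by (auto simp: pair_vec_def intro!: sum.cong)
  have iff: "(\<xi>, \<xi>') \<in> observable_congruence n A C \<longleftrightarrow> pair_vec (\<xi>, \<xi>') \<in> ?R"
    if "\<xi> \<in> carrier_vec n" "\<xi>' \<in> carrier_vec n" for \<xi> \<xi>'
  proof -
    have "pair_vec (\<xi>, \<xi>') \<in> carrier_vec (2 * n)"
      using that by (simp add: pair_vec_def mult_2)
    then show ?thesis
      using that by (auto simp: observable_congruence_def mult app simp del: index_mult_mat)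
  qed
  show ?thesis
  proof (intro equalityI subsetI)
    fix x assume "x \<in> pair_vec ` observable_congruence n A C"
    then obtain \<xi> \<xi>' where "x = pair_vec (\<xi>, \<xi>')" "(\<xi>, \<xi>') \<in> observable_congruence n A C" by auto
    moreover from this have "\<xi> \<in> carrier_vec n" "\<xi>' \<in> carrier_vec n"
      by (auto simp: observable_congruence_def)
    ultimately show "x \<in> ?R" using iff by blast
  next
    fix x assume x: "x \<in> ?R"
    then have "x \<in> carrier_vec (n + n)" by (simp add: mult_2)
    then have "x = pair_vec (vec_first x n, vec_last x n)" by (simp add: pair_vec_def)
    then show "x \<in> pair_vec ` observable_congruence n A C"
      using x iff[of "vec_first x n" "vec_last x n"] by (metis (no_types, lifting) imageI vec_first_carrier vec_last_carrier)
  qed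
qed

theorem theorem4p3:
  fixes A C :: "zmax mat" and n q :: nat
  assumes "A \<in> carrier_mat n n" and "C \<in> carrier_mat q n"
  shows "rational_subsemimodule (2 * n) (pair_vec ` observable_congruence n A C)"
proof -
  define s where "s k i j = (C * A ^\<^sub>m k) $$ (i, j)" for k i j
  define X where "X = {x \<in> carrier_vec (2 * n). \<forall>i<q. \<forall>k.
    (\<Sum>j<n. s k i j * x $ j) = (\<Sum>j<n. s k i j * x $ (n + j))}"
  have X: "pair_vec ` observable_congruence n A C = X"
    unfolding X_def s_def by (rule pair_vec_observable_congruence[OF assms])
  have sub: "subsemimodule (2 * n) X"
    unfolding subsemimodule_def
  proof (intro conjI ballI allI)
    show "X \<subseteq> carrier_vec (2 * n)" "0\<^sub>v (2 * n) \<in> X" by (auto simp: X_def)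
  next
    fix x y assume "x \<in> X" "y \<in> X"
    then show "x + y \<in> X" by (auto simp: X_def distrib_left sum.distrib)
  next
    fix c x assume "x \<in> X"
    moreover from this have "(\<Sum>j<n. s k i j * (c \<cdot>\<^sub>v x) $ j) = c * (\<Sum>j<n. s k i j * x $ j)"
      "(\<Sum>j<n. s k i j * (c \<cdot>\<^sub>v x) $ (n + j)) = c * (\<Sum>j<n. s k i j * x $ (n + j))" for k i
      by (auto simp: X_def sum_distrib_left mult.left_commute intro!: sum.cong)
    ultimately show "c \<cdot>\<^sub>v x \<in> X" by (simp add: X_def)
  qed
  have "\<exists>K D. 0 < D \<and>
      (\<forall>ij\<in>{..<q} \<times> {..<n}. affine_max_from K D (\<lambda>k. below (s k (fst ij) (snd ij))))"
  proof (rule affine_max_from_family)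
    fix ij assume "ij \<in> {..<q} \<times> {..<n}"
    then show "\<exists>K D. 0 < D \<and> affine_max_from K D (\<lambda>k. below (s k (fst ij) (snd ij)))"
      using ultimately_affine_mult_pow_mat[OF assms, of "fst ij" "snd ij"]
      by (simp add: ultimately_affine_def s_def mem_Times_iff)
  qed simp
  then obtain K D where D: "0 < D"
    and KD: "\<forall>ij\<in>{..<q} \<times> {..<n}. affine_max_from K D (\<lambda>k. below (s k (fst ij) (snd ij)))"
    by (elim exE conjE)
  \<comment> \<open>A pair \<open>(k, d)\<close> stands for the exponents \<open>k + d * p\<close>.
    Exponents below \<open>K\<close> are listed singly, with step 0; beyond \<open>K\<close> there
    is one progression of step \<open>D\<close> for each residue class.\<close>
  define \<K> where "\<K> = {..<K} \<times> {0} \<union> {K..<K + D} \<times> {D}"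
  have cover: "(\<forall>k. \<Phi> k) \<longleftrightarrow> (\<forall>(k, d)\<in>\<K>. \<forall>p. \<Phi> (k + d * p))" for \<Phi> :: "nat \<Rightarrow> bool"
  proof
    assume R: "\<forall>(k, d)\<in>\<K>. \<forall>p. \<Phi> (k + d * p)"
    show "\<forall>k. \<Phi> k"
    proof
      fix k
      show "\<Phi> k"
      proof (cases "k < K")
        case True
        then have "(k, 0) \<in> \<K>" by (simp add: \<K>_def)
        then have "\<Phi> (k + 0 * 0)" using R by blast
        then show ?thesis by simp
      next
        case False
        define r where "r = K + (k - K) mod D"
        have "(r, D) \<in> \<K>" using D by (auto simp: \<K>_def r_def)
        then have "\<Phi> (r + D * ((k - K) div D))" using R by blast
        then show ?thesis using False by (simp add: r_def)
      qed
    qed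
  qed auto
  have affine: "affine_max (\<lambda>p. below (s (k + d * p) i j))" if "(k, d) \<in> \<K>" "i < q" "j < n" for k d i j
  proof (cases "d = 0")
    case True
    have "affine_max (\<lambda>p. below z)" for z
    proof (cases z)
      case NegInf
      then show ?thesis by (simp add: affine_max_empty)
    next
      case (Fin a)
      then show ?thesis unfolding affine_max_def by (intro exI[of _ "{(a, 0)}"]) auto
    qed
    then show ?thesis using True by simp
  next
    case False
    then have "d = D" "K \<le> k" using that by (auto simp: \<K>_def)
    then show ?thesis using bspec[OF KD, of "(i, j)"] that by (simp add: affine_max_from_def)
  qed
  define \<Phi> where "\<Phi> S f \<longleftrightarrow> (\<forall>i\<in>{..<q}. \<forall>(k, d)\<in>\<K>. \<forall>p.
    (\<Sum>j<n. s (k + d * p) i j * masked S f j) = (\<Sum>j<n. s (k + d * p) i j * masked S f (n + j)))"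
    for S f
  have X_iff: "vec (2 * n) (masked S f) \<in> X \<longleftrightarrow> \<Phi> S f" for S f
  proof -
    define E where "E i k \<longleftrightarrow>
      (\<Sum>j<n. s k i j * masked S f j) = (\<Sum>j<n. s k i j * masked S f (n + j))" for i k
    have "(\<Sum>j<n. t j * vec (2 * n) (masked S f) $ (d + j)) = (\<Sum>j<n. t j * masked S f (d + j))"
      if "d \<le> n" for t :: "nat \<Rightarrow> zmax" and d
      using that by (intro sum.cong) auto
    from this[of 0] this[of n]
    have "vec (2 * n) (masked S f) \<in> X \<longleftrightarrow> (\<forall>i<q. \<forall>k. E i k)"
      by (simp add: X_def E_def)
    also have "\<dots> \<longleftrightarrow> (\<forall>i<q. \<forall>(k, d)\<in>\<K>. \<forall>p. E i (k + d * p))"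
      by (simp only: cover[of "E _"])
    also have "\<dots> \<longleftrightarrow> \<Phi> S f"
      unfolding \<Phi>_def E_def Ball_def lessThan_iff by (rule refl)
    finally show ?thesis .
  qed
  have "semilinear_condition (\<Phi> S)" for S
    unfolding \<Phi>_def split_beta
  proof (intro semilinear_condition_ball)
    fix i kd assume "i \<in> {..<q}" "kd \<in> \<K>"
    then have "affine_max (\<lambda>p. below (s (fst kd + snd kd * p) i j))" if "j < n" for j
      using that affine[of "fst kd" "snd kd" i j] by simp
    from semilinear_condition_linear_forms_eq[of n "\<lambda>j p. s (fst kd + snd kd * p) i j" S 0 n, OF this]
    show "semilinear_condition (\<lambda>f. \<forall>p.
        (\<Sum>j<n. s (fst kd + snd kd * p) i j * masked S f j) =
        (\<Sum>j<n. s (fst kd + snd kd * p) i j * masked S f (n + j)))"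
      by simp
  qed (simp_all add: \<K>_def)
  then have "semilinear UNIV {f \<in> {f. \<forall>i\<ge>2 * n. f i = 0}. \<Phi> S f}" for S
    using semilinear_int_vectors unfolding semilinear_condition_def by blast
  \<comment> \<open>There are finitely many supports \<open>S\<close>, and each contributes one
    rational set.\<close>
  then have "rational_subset (entrywise_monoid (2 * n))
      (\<Union>S\<in>Pow {..<2 * n}. (\<lambda>f. vec (2 * n) (masked S f)) ` {f \<in> {f. \<forall>i\<ge>2 * n. f i = 0}. \<Phi> S f})"
    by (intro rational_subset_UN rational_subset_masked) auto
  also have "(\<Union>S\<in>Pow {..<2 * n}. (\<lambda>f. vec (2 * n) (masked S f)) ` {f \<in> {f. \<forall>i\<ge>2 * n. f i = 0}. \<Phi> S f}) = X"
    (is "?U = X")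
  proof (intro equalityI subsetI)
    fix x assume x: "x \<in> X"
    then obtain S f where S: "S \<subseteq> {..<2 * n}" and f: "\<forall>i\<ge>2 * n. f i = 0"
      and x_eq: "x = vec (2 * n) (masked S f)"
      using masked_surj[of x "2 * n"] by (auto simp: X_def)
    have "\<Phi> S f" using x unfolding x_eq X_iff .
    then have "x \<in> (\<lambda>f. vec (2 * n) (masked S f)) ` {f \<in> {f. \<forall>i\<ge>2 * n. f i = 0}. \<Phi> S f}"
      unfolding x_eq using f by (intro imageI) simp
    then show "x \<in> ?U" using S by (intro UN_I[of S]) auto
  qed (auto simp: X_iff)
  finally have "rational_subset (entrywise_monoid (2 * n)) X" .
  with sub show ?thesis
    unfolding X rational_subsemimodule_def using semimodule_span_subsemimodule[OF sub] by metis
qed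

end
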